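(* Let $d\ge 1$ be an integer, let $p$ be a nearest-neighbour transition function on $\mathbb{Z}^d$ with $0<p(e)<1$ for all $e\in\mathcal{E}:=\{\pm e_j: 1\le j\le d\}$, $\sum_{e\in\mathcal{E}}p(e)=1$, $p(x)=0$ for $x\in\mathbb{Z}^d\setminus\mathcal{E}$, and with drift to the right, i.e. $\sum_{e\in\mathcal{E}}p(e)e=a e_1$ for some $a\in(0,1)$. Let $\mu$ be a probability distribution on $\mathbb{Z}_+=\{0,1,2,\dots\}$ such that $$\mathbb{E}_\mu\bigl[\log^+(\eta_x)^{\frac{d+1}{2}}\bigr]=\sum_{j=2}^\infty \log(j)^{\frac{d+1}{2}}\mu(j)=\infty .$$ Then the frog model on $\mathbb{Z}^d$ with underlying random walk given by $p$ and with i.i.d. initial configuration $\eta\sim\mathbb{P}_\mu=\mu^{\otimes\mathbb{Z}^d\setminus\{0\}}$ is recurrent, i.e. $$P\bigl(0\text{ is visited infinitely often}\bigr)=1 .$$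
   Context: $e_j$ denotes the $j$-th standard basis vector of $\mathbb{R}^d$, and $\log^+(t)=\max(\log t,0)$ for $t>0$, $\log^+(0)=0$. Frog model: given an initial configuration $\eta=(\eta_x)_{x\in\mathbb{Z}^d\setminus\{0\}}\in\mathbb{Z}_+^{\mathbb{Z}^d\setminus\{0\}}$, at time $0$ there is exactly one active frog at the origin $0$ and there are $\eta_x$ sleeping frogs at each $x\ne 0$. Each active frog performs a discrete-time random walk on $\mathbb{Z}^d$ with transition probabilities $p(x,y)=p(y-x)$, independently of all other frogs. Whenever an active frog hits a vertex $x$ with sleeping frogs, all sleeping frogs at $x$ become active at once and start independent random walks from $x$ with the same transition probabilities $p$; frogs never die or fall asleep again. $P_\eta$ denotes the law of this process with initial configuration $\eta$. $\mathbb{P}_\mu=\mu^{\otimes\mathbb{Z}^d\setminus\{0\}}$ is the product measure under which the $\eta_x$ are i.i.d. with law $\mu$, $\mathbb{E}_\mu$ is its expectation, and $P(A)=\int P_\eta(A)\,\mathbb{P}_\mu(d\eta)$ is the law of the frog model with random i.i.d. initial configuration. "0 is visited infinitely often" means that the origin is visited infinitely often by active frogs. *)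

theory Defs
  imports "HOL-Probability.Probability"
begin

text \<open>The lattice \<open>\<int>\<^sup>d\<close> is \<^typ>\<open>int ^ 'd\<close> with \<open>d = CARD('d)\<close>.\<close>

definition unit_steps :: "(int ^ 'd::finite) set" where
  "unit_steps = {e. \<exists>j. e = axis j 1 \<or> e = - axis j 1}"

definition real_vec :: "int ^ 'd::finite \<Rightarrow> real ^ 'd" where
  "real_vec x = (\<chi> j. real_of_int (x $ j))"

definition log_plus :: "real \<Rightarrow> real" where
  "log_plus t = (if t = 0 then 0 else max (ln t) 0)"

text \<open>
  The frog \<open>(x, i)\<close> is the \<open>i\<close>-th frog initially located at \<open>x\<close>; the frog that is active at time 0
  is \<open>(0, 0)\<close>.  Every potential frog carries its own sequence of increments, and \<open>\<xi> (f, k)\<close> is the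
  \<open>k\<close>-th increment of \<open>f\<close> counted from its own activation (not from time 0).
\<close>

type_synonym 'd frog = "(int ^ 'd) \<times> nat"

definition increments :: "(int ^ 'd::finite) pmf \<Rightarrow> ('d frog \<times> nat \<Rightarrow> int ^ 'd) measure" where
  "increments p = PiM UNIV (\<lambda>_. measure_pmf p)"

definition walk :: "('d::finite frog \<times> nat \<Rightarrow> int ^ 'd) \<Rightarrow> 'd frog \<Rightarrow> nat \<Rightarrow> int ^ 'd" where
  "walk \<xi> f k = fst f + (\<Sum>l<k. \<xi> (f, l))"

text \<open>
  \<open>frog_age \<eta> \<xi> n f\<close> is \<open>Some k\<close> if at time \<open>n\<close> the frog \<open>f\<close> is active and has made \<open>k\<close> steps so far,
  and \<open>None\<close> if \<open>f\<close> is asleep (or does not exist).  The value \<open>\<eta> 0\<close> is never used.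
\<close>

primrec frog_age ::
  "(int ^ 'd \<Rightarrow> nat) \<Rightarrow> ('d::finite frog \<times> nat \<Rightarrow> int ^ 'd) \<Rightarrow> nat \<Rightarrow> 'd frog \<Rightarrow> nat option"
where
  "frog_age \<eta> \<xi> 0 = (\<lambda>f. if f = (0, 0) then Some 0 else None)"
| "frog_age \<eta> \<xi> (Suc n) = (\<lambda>f.
     case frog_age \<eta> \<xi> n f of
       Some k \<Rightarrow> Some (Suc k)
     | None \<Rightarrow>
         if fst f \<noteq> 0 \<and> snd f < \<eta> (fst f) \<and>
            (\<exists>g k. frog_age \<eta> \<xi> n g = Some k \<and> walk \<xi> g (Suc k) = fst f)
         then Some 0 else None)"

text \<open>A path records, for each time and each frog, the position of the frog if it is active.\<close>

type_synonym 'd frog_path = "nat \<Rightarrow> 'd frog \<Rightarrow> (int ^ 'd) option"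

definition frog_path ::
  "(int ^ 'd \<Rightarrow> nat) \<Rightarrow> ('d::finite frog \<times> nat \<Rightarrow> int ^ 'd) \<Rightarrow> 'd frog_path" where
  "frog_path \<eta> \<xi> n f = map_option (walk \<xi> f) (frog_age \<eta> \<xi> n f)"

text \<open>The quenched law \<open>P\<^sub>\<eta>\<close>, the law \<open>\<bbbP>\<^sub>\<mu>\<close> of the initial configuration, and the annealed law \<open>P\<close>.\<close>

definition quenched_prob ::
  "(int ^ 'd::finite) pmf \<Rightarrow> (int ^ 'd \<Rightarrow> nat) \<Rightarrow> 'd frog_path set \<Rightarrow> real" where
  "quenched_prob p \<eta> A =
     measure (increments p) {\<xi> \<in> space (increments p). frog_path \<eta> \<xi> \<in> A}"

definition iid_config :: "nat pmf \<Rightarrow> (int ^ 'd::finite \<Rightarrow> nat) measure" where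
  "iid_config \<mu> = PiM (UNIV - {0}) (\<lambda>_. measure_pmf \<mu>)"

definition frog_prob ::
  "(int ^ 'd::finite) pmf \<Rightarrow> nat pmf \<Rightarrow> 'd frog_path set \<Rightarrow> real" where
  "frog_prob p \<mu> A = (LINT \<eta>|iid_config \<mu>. quenched_prob p \<eta> A)"

definition origin_visited_infinitely_often :: "'d::finite frog_path set" where
  "origin_visited_infinitely_often = {X. infinite {n. \<exists>f. X n f = Some 0}}"

end

(*
  Consider only the first frog of every vertex, and the parabola of points v + z with z in layer
  n = z_1 and 0 <= z_j <= sqrt n for the other coordinates.  A frog in layer between n/4 and n/2
  reaches a given point of layer n with probability at least c n^(-d/2) and
  there are of order n^((d+1)/2) such frogs if the whole parabola below layer n/2 is visited.  So a
  given point of layer n is missed with probability at most exp (-c sqrt n), which is summable over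
  the points of the parabola: once the layers below a large N are visited, all of the parabola is
  visited with probability close to 1.  To get started, the initial frog a.s. meets a vertex v whose
  own frogs reach all points in the layers below N, since it meets infinitely many vertices and each
  has a fixed positive chance to do this.  Finally, as sum_n n^((d-1)/2) mu {k. k >= exp (C n)} is
  infinite, the parabola a.s. contains infinitely many points y with exp (C |y|) frogs, one of which
  returns to 0.
*)
theory Submission
  imports Defs
begin

section \<open>Hitting probabilities of the random walk\<close>

text \<open>Every potential frog owns a path, whether it wakes or not, so all probability estimates
  concern static events of a product space; the dynamics enters through one deterministic induction
  over the layers. The obstacle is that the vertex v at which the parabola starts is random.
  Therefore the spreading estimate is uniform in v, and v is chosen by one family of coordinates
  while the spreading depends on a disjoint one. The returns to 0 hold almost surely for all v at
  once, so they may be intersected with the rest without any independence. The hitting bound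
  n^(-d/2) looks at a single time, when the drift alone leads to the right layer; other times near
  it are ignored, a loss which the number of frogs absorbs. Poissonization turns this bound into a
  product of one-dimensional estimates. The exponent (d+1)/2 of the hypothesis is the volume of the
  parabola: below layer log k it has about (log k)^((d+1)/2) points, and a vertex in layer n is as
  good as certain to send a frog back once it has exponentially many frogs in n.\<close>

lemma ln_one_plus_ge:
  fixes x :: real
  assumes "0 \<le> x"
  shows "2 * x / (2 + x) \<le> ln (1 + x)"
proof -
  define f where "f y = ln (1 + y) - 2 * y / (2 + y)" for y :: real
  have "f 0 \<le> f x"
  proof (rule DERIV_nonneg_imp_nondecreasing[OF assms])
    fix y :: real assume y: "0 \<le> y" "y \<le> x"
    have "(f has_real_derivative 1 / (1 + y) - (2 * (2 + y) - 2 * y) / (2 + y)^2) (at y)"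
      unfolding f_def using y by (auto intro!: derivative_eq_intros simp: power2_eq_square)
    moreover have "0 \<le> 1 / (1 + y) - (2 * (2 + y) - 2 * y) / (2 + y)^2"
    proof -
      have "1 / (1 + y) - (2 * (2 + y) - 2 * y) / (2 + y)^2 = y^2 / ((1 + y) * (2 + y)^2)"
        using y by (simp add: divide_simps power2_eq_square) (auto simp: algebra_simps)
      then show ?thesis using y by simp
    qed
    ultimately show "\<exists>D. (f has_real_derivative D) (at y) \<and> 0 \<le> D" by blast
  qed
  then show ?thesis by (simp add: f_def)
qed

text \<open>Lower bounds on Poisson weights need an upper bound on \<open>fact n\<close> with the
  correct factor \<open>sqrt n\<close>. The constant \<open>exp 1\<close> makes both sides equal at
  \<open>n = 1\<close>.\<close>

lemma fact_le_stirling: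
  assumes "1 \<le> n"
  shows "fact n \<le> exp 1 * sqrt n * (real n / exp 1) ^ n"
  using assms
proof (induction n rule: nat_induct_at_least)
  case base
  then show ?case by simp
next
  case (Suc n)
  have n: "0 < real n" using Suc by simp
  \<comment> \<open>In logarithms this is \<open>1 \<le> (n + 1/2) * ln (1 + 1/n)\<close>, for which
    the bounds \<open>x / (1 + x)\<close> and \<open>x - x^2 / 2\<close> of
    \<open>ln (1 + x)\<close> just fail; at \<open>x = 1/n\<close> the bound
    \<open>2 * x / (2 + x)\<close> is exactly \<open>1 / (n + 1/2)\<close>.\<close>
  have key: "exp 1 * sqrt n * real n ^ n \<le> sqrt (Suc n) * real (Suc n) ^ n"
  proof -
    have "1 \<le> (real n + 1/2) * ln (1 + 1 / real n)"
    proof -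
      have "2 * (1 / real n) / (2 + 1 / real n) \<le> ln (1 + 1 / real n)"
        by (rule ln_one_plus_ge) simp
      moreover have "2 * (1 / real n) / (2 + 1 / real n) = 1 / (real n + 1/2)"
        using n by (simp add: field_simps)
      ultimately show ?thesis using n by (simp add: field_simps)
    qed
    also have "1 + 1 / real n = real (Suc n) / real n"
      using n by (simp add: field_simps)
    also have "ln (real (Suc n) / real n) = ln (real (Suc n)) - ln n"
      using n by (subst ln_div) auto
    finally have "1 + ln n / 2 + n * ln n \<le> ln (real (Suc n)) / 2 + n * ln (real (Suc n))"
      by (simp add: algebra_simps)
    then have "exp (1 + ln n / 2 + n * ln n) \<le> exp (ln (real (Suc n)) / 2 + n * ln (real (Suc n)))"
      by (simp del: of_nat_Suc)
    moreover have "exp (ln y / 2) = sqrt y" "exp (n * ln y) = y ^ n" if "0 < y" for y :: real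
      using that by (simp_all add: ln_sqrt[symmetric] exp_of_nat_mult)
    ultimately show ?thesis using n by (simp add: exp_add del: of_nat_Suc)
  qed
  have "fact (Suc n) \<le> real (Suc n) * (exp 1 * sqrt n * (real n / exp 1) ^ n)"
    using Suc.IH by (simp add: mult_left_mono del: of_nat_Suc)
  also have "\<dots> = real (Suc n) / exp 1 ^ n * (exp 1 * sqrt n * real n ^ n)"
    by (simp add: power_divide)
  also have "\<dots> \<le> real (Suc n) / exp 1 ^ n * (sqrt (Suc n) * real (Suc n) ^ n)"
    by (rule mult_left_mono[OF key]) simp
  also have "\<dots> = exp 1 * sqrt (Suc n) * (real (Suc n) / exp 1) ^ Suc n"
    by (simp add: power_divide)
  finally show ?case .
qed

text \<open>By Stirling the exponent is \<open>n - l - n * ln (n / l)\<close>, and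
  \<open>ln y \<le> y - 1\<close> at \<open>y = n / l\<close> turns it into
  \<open>- (n - l)^2 / l\<close>. Compared with the Gaussian only a factor 2 in the exponent is
  lost, so the weights keep the order \<open>1 / sqrt n\<close> in a window of width
  \<open>sqrt l\<close> around the mean.\<close>

lemma poisson_density_ge:
  fixes l :: real
  assumes "0 < l" "1 \<le> n"
  shows "exp (- (real n - l)\<^sup>2 / l) / (exp 1 * sqrt n) \<le> exp (- l) * l ^ n / fact n"
proof -
  have n: "0 < real n" using assms by simp
  have "ln (real n / l) \<le> real n / l - 1"
    using n assms by (intro ln_le_minus_one) simp
  then have "n * ln (real n / l) \<le> n * (real n / l - 1)"
    by (rule mult_left_mono) simp
  moreover have "ln (real n / l) = ln n - ln l"
    using n assms by (simp add: ln_div)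
  moreover have "- (real n - l)\<^sup>2 / l = n - l - n * (real n / l - 1)"
    using assms by (simp add: field_simps power2_eq_square)
  ultimately have "- (real n - l)\<^sup>2 / l \<le> n * ln l + (n - l - n * ln n)"
    by (simp add: algebra_simps)
  then have "exp (- (real n - l)\<^sup>2 / l) \<le> exp (n * ln l + (n - l - n * ln n))" by simp
  also have "\<dots> = exp (- l) * l ^ n / (real n / exp 1) ^ n"
  proof -
    have "exp (n * ln y) = y ^ n" if "0 < y" for y :: real
      using that by (simp add: exp_of_nat_mult)
    moreover have "exp (real n) = exp 1 ^ n" using exp_of_nat_mult[of n 1] by simp
    ultimately show ?thesis
      using n assms by (simp add: exp_add exp_diff exp_minus power_mult_distrib power_inverse divide_inverse mult_ac)
  qed
  finally have "exp (- (real n - l)\<^sup>2 / l) / (exp 1 * sqrt n)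
      \<le> exp (- l) * l ^ n / (real n / exp 1) ^ n / (exp 1 * sqrt n)"
    by (rule divide_right_mono) simp
  also have "\<dots> = exp (- l) * l ^ n / (exp 1 * sqrt n * (real n / exp 1) ^ n)"
    by (simp add: field_simps)
  also have "\<dots> \<le> exp (- l) * l ^ n / fact n"
    using fact_le_stirling[OF assms(2)] assms by (intro divide_left_mono) auto
  finally show ?thesis .
qed

lemma sum_poisson_le_1:
  fixes t :: real
  assumes "0 \<le> t" "finite K"
  shows "(\<Sum>k\<in>K. exp (- t) * t ^ k / fact k) \<le> 1"
proof -
  have "(\<Sum>k\<in>K. t ^ k /\<^sub>R fact k) \<le> exp t"
    unfolding exp_def using assms by (intro sum_le_suminf summable_exp_generic) auto
  then have "exp (- t) * (\<Sum>k\<in>K. t ^ k /\<^sub>R fact k) \<le> exp (- t) * exp t"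
    by (rule mult_left_mono) simp
  then show ?thesis
    by (simp add: sum_distrib_left exp_minus divide_inverse mult_ac)
qed

section \<open>Direction counts and superharmonic lower bounds\<close>

definition step :: "'d::finite \<times> bool \<Rightarrow> int ^ 'd" where
  "step i = (if snd i then axis (fst i) 1 else - axis (fst i) 1)"

text \<open>The number of steps in each direction of a path that ends at \<open>z\<close>.\<close>

definition step_counts :: "int ^ 'd \<Rightarrow> ('d::finite \<times> bool \<Rightarrow> nat) set" where
  "step_counts z = {n. \<forall>j. z $ j = int (n (j, True)) - int (n (j, False))}"

lemma step_nth: "step (j, b) $ k = (if k = j then (if b then 1 else -1) else 0)"
  by (simp add: step_def axis_def)

lemma inj_step: "inj (step :: 'd::finite \<times> bool \<Rightarrow> _)"
proof (rule injI)
  fix u v :: "'d \<times> bool"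
  assume "step u = step v"
  moreover obtain j b j' b' where "u = (j, b)" "v = (j', b')" by (metis surj_pair)
  ultimately have "step (j, b) $ k = step (j', b') $ k" for k by simp
  from this[of j] this[of j'] \<open>u = _\<close> \<open>v = _\<close> show "u = v"
    by (auto simp: step_nth split: if_splits)
qed

lemma range_step: "range step = unit_steps"
  unfolding unit_steps_def by (auto simp: step_def image_iff)

lemma step_counts_decr:
  assumes "n \<in> step_counts z" "n i \<noteq> 0"
  shows "n(i := n i - 1) \<in> step_counts (z - step i)"
proof -
  obtain j b where i: "i = (j, b)" by (metis surj_pair)
  have "n (j, b) \<ge> 1" using assms i by simp
  then show ?thesis
    using assms(1) unfolding step_counts_def i by (cases b) (auto simp: step_nth of_nat_diff)
qed

text \<open>The model for \<open>H z\<close> is the probability that the walk from 0 ever hits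
  \<open>z\<close>. The decomposition by the first step is stated as an inequality, so that
  \<open>z = 0\<close> is no exception.\<close>

locale superharmonic =
  fixes q :: "'d::finite \<times> bool \<Rightarrow> real" and H :: "int ^ 'd \<Rightarrow> real"
  assumes q_pos: "\<And>i. 0 < q i" and sum_q: "(\<Sum>i\<in>UNIV. q i) = 1"
    and H_nonneg: "\<And>z. 0 \<le> H z" and H_0: "H 0 = 1"
    and H_step: "\<And>z. (\<Sum>i\<in>UNIV. q i * H (z - step i)) \<le> H z"
begin

text \<open>The probability that the first \<open>\<Sum>i. n i\<close> steps take direction
  \<open>i\<close> exactly \<open>n i\<close> times.\<close>

definition multinomial :: "('d \<times> bool \<Rightarrow> nat) \<Rightarrow> real" where
  "multinomial n = fact (\<Sum>i\<in>UNIV. n i) * (\<Prod>i\<in>UNIV. q i ^ n i / fact (n i))"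

text \<open>Decomposition by the first step: paths that begin with \<open>i\<close> make up the
  share \<open>n i / Suc k\<close> of the total, and these shares add up to 1.\<close>

lemma multinomial_step:
  assumes "(\<Sum>i\<in>UNIV. n i) = Suc k"
  shows "multinomial n = (\<Sum>i | n i \<noteq> 0. q i * multinomial (n(i := n i - 1)))"
proof -
  let ?P = "\<Prod>i\<in>UNIV. q i ^ n i / fact (n i)"
  have *: "q i * multinomial (n(i := n i - 1)) = fact k * ?P * n i" if "n i \<noteq> 0" for i
  proof -
    have s: "(\<Sum>j\<in>UNIV. (n(i := n i - 1)) j) = k"
    proof -
      have "(\<Sum>j\<in>UNIV. n j) = n i + (\<Sum>j\<in>UNIV - {i}. n j)" by (simp add: sum.remove)
      moreover have "(\<Sum>j\<in>UNIV. (n(i := n i - 1)) j) = n i - 1 + (\<Sum>j\<in>UNIV - {i}. n j)"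
        by (subst sum.remove[of _ i]) auto
      ultimately show ?thesis using assms that by simp
    qed
    define R where "R = (\<Prod>j\<in>UNIV - {i}. q j ^ n j / fact (n j))"
    obtain m where m: "n i = Suc m" using \<open>n i \<noteq> 0\<close> not0_implies_Suc by blast
    have 1: "multinomial (n(i := n i - 1)) = fact k * (q i ^ m / fact m * R)"
      unfolding multinomial_def s R_def by (subst prod.remove[of _ i]) (auto simp: m)
    have 2: "?P = q i ^ Suc m / fact (Suc m) * R"
      unfolding R_def by (subst prod.remove[of _ i]) (auto simp: m)
    have 3: "q i ^ Suc m / fact (Suc m) * real (Suc m) = q i * (q i ^ m / fact m)"
      by (simp add: divide_simps del: of_nat_Suc)
    have "fact k * ?P * n i = fact k * R * (q i ^ Suc m / fact (Suc m) * real (Suc m))"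
      unfolding 2 m by (simp only: mult_ac)
    then show ?thesis unfolding 1 3 by (simp only: mult_ac)
  qed
  have "(\<Sum>i | n i \<noteq> 0. q i * multinomial (n(i := n i - 1))) = (\<Sum>i | n i \<noteq> 0. fact k * ?P * n i)"
    using * by (intro sum.cong) auto
  also have "\<dots> = (\<Sum>i\<in>UNIV. fact k * ?P * n i)"
    by (intro sum.mono_neutral_left) auto
  also have "\<dots> = fact k * ?P * real (\<Sum>i\<in>UNIV. n i)"
    by (simp add: sum_distrib_left)
  also have "\<dots> = multinomial n" unfolding multinomial_def assms by simp
  finally show ?thesis ..
qed

text \<open>Over all counts of total \<open>k\<close> the sum is the probability to be at
  \<open>z\<close> at time \<open>k\<close>; iterating \<open>H_step\<close> down to
  \<open>H 0 = 1\<close> bounds it by \<open>H z\<close>. Subsets \<open>W\<close> let the induction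
  hypothesis take the image of \<open>W\<close> under removal of one step.\<close>

lemma sum_multinomial_le:
  assumes "finite W" "W \<subseteq> {n \<in> step_counts z. (\<Sum>i\<in>UNIV. n i) = k}"
  shows "(\<Sum>n\<in>W. multinomial n) \<le> H z"
  using assms
proof (induction k arbitrary: z W)
  case 0
  have W: "W \<subseteq> {\<lambda>_. 0}" using 0 by (auto simp: fun_eq_iff)
  show ?case
  proof (cases "W = {}")
    case False
    then have "W = {\<lambda>_. 0}" using W by auto
    moreover from this have "z = 0" using 0 by (auto simp: step_counts_def vec_eq_iff)
    ultimately show ?thesis by (simp add: multinomial_def H_0)
  qed (simp add: H_nonneg)
next
  case (Suc k)
  have "(\<Sum>n\<in>W. multinomial n)
      = (\<Sum>n\<in>W. \<Sum>i | n i \<noteq> 0. q i * multinomial (n(i := n i - 1)))"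
    using Suc.prems by (intro sum.cong multinomial_step[where k = k]) auto
  also have "\<dots> = (\<Sum>i\<in>UNIV. \<Sum>n\<in>{n\<in>W. n i \<noteq> 0}. q i * multinomial (n(i := n i - 1)))"
    using Suc.prems sum.swap_restrict[of W UNIV
      "\<lambda>n i. q i * multinomial (n(i := n i - 1))" "\<lambda>n i. n i \<noteq> 0"] by simp
  also have "\<dots> = (\<Sum>i\<in>UNIV. q i * (\<Sum>n\<in>(\<lambda>n. n(i := n i - 1)) ` {n\<in>W. n i \<noteq> 0}. multinomial n))"
  proof (intro sum.cong refl)
    fix i
    have "inj_on (\<lambda>n. n(i := n i - 1)) {n\<in>W. n i \<noteq> 0}"
    proof (rule inj_onI)
      fix n m assume "n \<in> {n\<in>W. n i \<noteq> 0}" "m \<in> {n\<in>W. n i \<noteq> 0}"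
        and eq: "n(i := n i - 1) = m(i := m i - 1)"
      then have "n i = m i"
        by (metis (mono_tags, lifting) One_nat_def Suc_pred fun_upd_same mem_Collect_eq not_gr_zero)
      moreover have "n j = m j" if "j \<noteq> i" for j using eq that by (metis fun_upd_apply)
      ultimately show "n = m" by (metis ext)
    qed
    then show "(\<Sum>n\<in>{n\<in>W. n i \<noteq> 0}. q i * multinomial (n(i := n i - 1))) =
      q i * (\<Sum>n\<in>(\<lambda>n. n(i := n i - 1)) ` {n\<in>W. n i \<noteq> 0}. multinomial n)"
      by (simp add: sum.reindex sum_distrib_left)
  qed
  also have "\<dots> \<le> (\<Sum>i\<in>UNIV. q i * H (z - step i))"
  proof (intro sum_mono mult_left_mono)
    fix i
    show "(\<Sum>n\<in>(\<lambda>n. n(i := n i - 1)) ` {n\<in>W. n i \<noteq> 0}. multinomial n) \<le> H (z - step i)"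
    proof (rule Suc.IH)
      show "finite ((\<lambda>n. n(i := n i - 1)) ` {n\<in>W. n i \<noteq> 0})" using Suc.prems by simp
      show "(\<lambda>n. n(i := n i - 1)) ` {n\<in>W. n i \<noteq> 0} \<subseteq> {n \<in> step_counts (z - step i). (\<Sum>i\<in>UNIV. n i) = k}"
      proof safe
        fix n assume n: "n \<in> W" "0 < n i"
        then show "n(i := n i - 1) \<in> step_counts (z - step i)"
          using Suc.prems by (intro step_counts_decr) auto
        have "(\<Sum>j\<in>UNIV. n j) = n i + (\<Sum>j\<in>UNIV - {i}. n j)" by (simp add: sum.remove)
        moreover have "(\<Sum>j\<in>UNIV. (n(i := n i - 1)) j) = n i - 1 + (\<Sum>j\<in>UNIV - {i}. n j)"
          by (subst sum.remove[of _ i]) auto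
        ultimately show "(\<Sum>j\<in>UNIV. (n(i := n i - 1)) j) = k" using Suc.prems n by auto
      qed
    qed
  qed (use q_pos in \<open>auto intro: less_imp_le\<close>)
  also have "\<dots> \<le> H z" by (rule H_step)
  finally show ?case .
qed

text \<open>Running the walk at the times of a Poisson process of rate \<open>1\<close> makes the numbers of steps in
  the different directions independent, and does not change the set of visited vertices.\<close>

lemma sum_poisson_product_le:
  assumes "0 \<le> t" "finite W" "W \<subseteq> step_counts z"
  shows "(\<Sum>n\<in>W. \<Prod>i\<in>UNIV. exp (- (t * q i)) * (t * q i) ^ n i / fact (n i)) \<le> H z"
proof -
  let ?s = "\<lambda>n :: 'd \<times> bool \<Rightarrow> nat. \<Sum>i\<in>UNIV. n i"
  let ?pois = "\<lambda>k. exp (- t) * t ^ k / fact k"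
  have eq: "(\<Prod>i\<in>UNIV. exp (- (t * q i)) * (t * q i) ^ n i / fact (n i)) = ?pois (?s n) * multinomial n" for n
  proof -
    have "(\<Prod>i\<in>UNIV. exp (- (t * q i)) * (t * q i) ^ n i / fact (n i))
       = (\<Prod>i\<in>UNIV. exp (- (t * q i))) * (\<Prod>i\<in>UNIV. t ^ n i) * (\<Prod>i\<in>UNIV. q i ^ n i / fact (n i))"
      by (simp add: power_mult_distrib prod.distrib[symmetric] mult_ac)
    also have "(\<Prod>i\<in>UNIV. exp (- (t * q i))) = exp (- t)"
      by (simp add: exp_sum[symmetric] sum_negf sum_distrib_left[symmetric] sum_q)
    finally show ?thesis by (simp add: multinomial_def power_sum)
  qed
  have "(\<Sum>n\<in>W. ?pois (?s n) * multinomial n)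
      = (\<Sum>k\<in>?s ` W. \<Sum>n\<in>{n\<in>W. ?s n = k}. ?pois (?s n) * multinomial n)"
    using assms by (intro sum.image_gen) auto
  also have "\<dots> = (\<Sum>k\<in>?s ` W. ?pois k * (\<Sum>n\<in>{n\<in>W. ?s n = k}. multinomial n))"
    by (intro sum.cong refl) (simp add: sum_distrib_left)
  also have "\<dots> \<le> (\<Sum>k\<in>?s ` W. ?pois k * H z)"
    using assms by (intro sum_mono mult_left_mono sum_multinomial_le) auto
  also have "\<dots> = (\<Sum>k\<in>?s ` W. ?pois k) * H z" by (simp add: sum_distrib_right)
  also have "\<dots> \<le> 1 * H z"
    using assms by (intro mult_right_mono sum_poisson_le_1 H_nonneg) auto
  finally show ?thesis by (simp add: eq)
qed

section \<open>Lower bounds for the hitting probabilities\<close>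

lemma H_ge_step: "q i * H (z - step i) \<le> H z"
proof -
  have "q i * H (z - step i) \<le> (\<Sum>i\<in>UNIV. q i * H (z - step i))"
    by (rule member_le_sum) (auto intro: mult_nonneg_nonneg less_imp_le[OF q_pos] H_nonneg)
  then show ?thesis using H_step[of z] by simp
qed

text \<open>A shortest path to \<open>z\<close> has \<open>m\<close> steps, each of probability at
  least \<open>c\<close>; the induction takes one step along a coordinate in which \<open>z\<close>
  is nonzero, with the sign of that coordinate.\<close>

lemma H_ge_power:
  assumes "0 < c" "\<And>i. c \<le> q i" "(\<Sum>j\<in>UNIV. \<bar>z $ j\<bar>) = int m"
  shows "c ^ m \<le> H z"
  using assms(3)
proof (induction m arbitrary: z)
  case 0
  then have "z = 0" by (simp add: vec_eq_iff sum_nonneg_eq_0_iff)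
  then show ?case by (simp add: H_0)
next
  case (Suc m)
  then obtain j where j: "z $ j \<noteq> 0" by (force intro: sum.neutral)
  define i where "i = (j, z $ j > 0)"
  have "(\<Sum>k\<in>UNIV. \<bar>(z - step i) $ k\<bar>) = int m"
  proof -
    have "(\<Sum>k\<in>UNIV. \<bar>z $ k\<bar>) = \<bar>z $ j\<bar> + (\<Sum>k\<in>UNIV - {j}. \<bar>z $ k\<bar>)" by (simp add: sum.remove)
    moreover have "(\<Sum>k\<in>UNIV. \<bar>(z - step i) $ k\<bar>) = \<bar>z $ j\<bar> - 1 + (\<Sum>k\<in>UNIV - {j}. \<bar>z $ k\<bar>)"
      using j by (subst sum.remove[of _ j]) (auto simp: step_nth i_def)
    ultimately show ?thesis using Suc.prems by simp
  qed
  then have "c ^ m \<le> H (z - step i)" by (rule Suc.IH)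
  then have "c * c ^ m \<le> q i * H (z - step i)"
    using assms less_imp_le[OF q_pos] by (intro mult_mono) auto
  with H_ge_step[of i z] show ?case by simp
qed

lemma ex_q_lower_bound: "\<exists>k>0. k \<le> 1 \<and> (\<forall>i. k \<le> q i)"
proof (intro exI conjI allI)
  have "Min (range q) \<in> range q" by (rule Min_in) auto
  then show "0 < Min (range q)" using q_pos by auto
  show min_le: "Min (range q) \<le> q i" for i by simp
  have "q i \<le> (\<Sum>i\<in>UNIV. q i)" for i
    by (rule member_le_sum) (auto intro: less_imp_le[OF q_pos])
  then show "Min (range q) \<le> 1" using min_le order_trans unfolding sum_q by blast
qed

text \<open>The walk is observed at one time \<open>t\<close> of a rate 1 Poisson clock. In each
  coordinate the number of backward steps may take about \<open>sqrt t\<close> values near its mean,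
  the number of forward steps is then forced, and both Poisson weights are at least of order
  \<open>1 / sqrt t\<close>; so each coordinate contributes a factor of order
  \<open>1 / sqrt t\<close>.\<close>

lemma H_ge_sqrt_power:
  assumes "0 < a" "a \<le> 1"
    and drift: "\<And>j. q (j, True) - q (j, False) = (if j = j1 then a else 0)"
  shows "\<exists>c>0. \<exists>r0. \<forall>z r. r0 \<le> r \<longrightarrow> z $ j1 = int r \<longrightarrow>
    (\<forall>j. j \<noteq> j1 \<longrightarrow> \<bar>real_of_int (z $ j)\<bar> \<le> 2 * sqrt r) \<longrightarrow> c / sqrt r ^ CARD('d) \<le> H z"
proof -
  obtain k where "0 < k" and k_le: "\<And>i. k \<le> q i" using ex_q_lower_bound by blast
  have q_le: "q i \<le> 1" for i
  proof -
    have "q i \<le> (\<Sum>i\<in>UNIV. q i)"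
      by (rule member_le_sum) (auto intro: less_imp_le[OF q_pos])
    then show ?thesis by (simp add: sum_q)
  qed
  \<comment> \<open>With \<open>u = sqrt t\<close>, each Poisson weight will be at least
    \<open>b / u\<close>: the counts deviate by at most \<open>3 * u\<close> from means of at least
    \<open>k * t\<close>, whence \<open>9 / k\<close>, and they are at most \<open>4 * t\<close>,
    whence the 2.\<close>
  define b where "b = exp (- (9 / k)) / (exp 1 * 2)"
  have "0 < b" by (simp add: b_def)
  \<comment> \<open>Per coordinate: \<open>u / 2\<close> choices times two weights
    \<open>b / u\<close>, that is \<open>(b^2 / 2) / u\<close>; the factor \<open>sqrt a\<close>
    converts \<open>1 / u\<close> into \<open>1 / sqrt r\<close>.\<close>
  define c where "c = (b\<^sup>2 / 2) ^ CARD('d) * sqrt a ^ CARD('d)"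
  have "0 < c" using \<open>0 < b\<close> \<open>0 < a\<close> by (simp add: c_def)
  \<comment> \<open>Large enough for \<open>4 \<le> u\<close> and
    \<open>1 + 3 * u \<le> k * t\<close>, so that counts within \<open>3 * u\<close> of their means
    are at least 1.\<close>
  obtain r1 :: nat where r1: "16 + (6 / k)\<^sup>2 + 2 / k \<le> r1" using real_arch_simple by blast
  have "c / sqrt r ^ CARD('d) \<le> H z"
    if r: "r1 \<le> r" and z1: "z $ j1 = int r"
      and zj: "\<And>j. j \<noteq> j1 \<Longrightarrow> \<bar>real_of_int (z $ j)\<bar> \<le> 2 * sqrt r" for z r
  proof -
    \<comment> \<open>At this time the mean displacement is \<open>t * a = r\<close> in coordinate
      \<open>j1\<close> and 0 in the others; \<open>D j\<close> below is the deviation of the target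
      from it.\<close>
    define t where "t = r / a"
    have "r \<le> t" using assms by (simp add: t_def field_simps mult_left_le_one_le)
    have "r1 \<le> t" using r \<open>r \<le> t\<close> by linarith
    have "16 \<le> t" "(6 / k)\<^sup>2 \<le> t" "2 / k \<le> t"
      using r1 \<open>r1 \<le> t\<close> \<open>0 < k\<close> by (auto intro: order_trans[rotated])
    define u where "u = sqrt t"
    have tu: "t = u * u" and u: "4 \<le> u" "6 / k \<le> u"
      using \<open>16 \<le> t\<close> \<open>(6 / k)\<^sup>2 \<le> t\<close> by (auto simp: u_def intro!: real_le_rsqrt)
    have "sqrt r \<le> u" using \<open>r \<le> t\<close> by (simp add: u_def)
    define l where "l i = t * q i" for i
    have l_ge: "k * t \<le> l i" for i using k_le[of i] \<open>16 \<le> t\<close> by (simp add: l_def mult.commute)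
    have l_le: "l i \<le> t" for i using q_le[of i] \<open>16 \<le> t\<close> by (simp add: l_def mult_left_le)
    have l_pos: "0 < l i" for i using q_pos[of i] \<open>16 \<le> t\<close> by (simp add: l_def)
    have ku: "1 + 3 * u \<le> k * t"
    proof -
      have "6 * u \<le> k * u * u" using u \<open>0 < k\<close> by (intro mult_right_mono) (auto simp: field_simps)
      moreover have "2 \<le> k * t" using \<open>2 / k \<le> t\<close> \<open>0 < k\<close> by (simp add: field_simps)
      ultimately show ?thesis by (simp add: tu)
    qed
    define D where "D j = real_of_int (z $ j) - (l (j, True) - l (j, False))" for j
    have D: "\<bar>D j\<bar> \<le> 2 * u" for j
    proof (cases "j = j1")
      case True
      have "l (j1, True) - l (j1, False) = t * (q (j1, True) - q (j1, False))"
        by (simp add: l_def algebra_simps)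
      then have "D j1 = 0" using assms by (simp add: D_def z1 drift t_def)
      then show ?thesis using u True by simp
    next
      case False
      have "l (j, True) - l (j, False) = t * (q (j, True) - q (j, False))"
        by (simp add: l_def algebra_simps)
      then have "D j = z $ j" using False by (simp add: D_def drift)
      then show ?thesis using zj[OF False] \<open>sqrt r \<le> u\<close> by simp
    qed
    \<comment> \<open>Backward counts in a window of width \<open>u\<close>. The forward count then
      differs from its mean by \<open>m - l (j, False) + D j\<close>, hence by at most
      \<open>3 * u\<close>.\<close>
    define Mj where "Mj j = {m::nat. l (j, False) \<le> m \<and> m \<le> l (j, False) + u}" for j
    have Mj_fin: "finite (Mj j)" for j
    proof (rule finite_subset)
      show "Mj j \<subseteq> {..nat \<lceil>l (j, False) + u\<rceil>}" unfolding Mj_def by (auto simp: le_nat_iff) linarith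
    qed simp
    have Mj_card: "u / 2 \<le> card (Mj j)" for j
    proof -
      define m0 where "m0 = nat \<lceil>l (j, False)\<rceil>"
      have m0: "l (j, False) \<le> m0" "m0 \<le> l (j, False) + 1"
        using l_pos[of "(j, False)"] unfolding m0_def by linarith+
      have "{m0 ..< m0 + nat \<lfloor>u\<rfloor>} \<subseteq> Mj j"
      proof
        fix m assume "m \<in> {m0 ..< m0 + nat \<lfloor>u\<rfloor>}"
        then have m: "m0 \<le> m" "m + 1 \<le> m0 + nat \<lfloor>u\<rfloor>" by auto
        then have "real m + 1 \<le> m0 + real (nat \<lfloor>u\<rfloor>)" by linarith
        moreover have "real (nat \<lfloor>u\<rfloor>) \<le> u" using u by simp
        ultimately show "m \<in> Mj j" using m m0 by (auto simp: Mj_def)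
      qed
      from card_mono[OF Mj_fin this] have "nat \<lfloor>u\<rfloor> \<le> card (Mj j)" by simp
      moreover have "u / 2 \<le> nat \<lfloor>u\<rfloor>" using u by linarith
      ultimately show ?thesis by linarith
    qed
    \<comment> \<open>The truncation by \<open>nat\<close> is harmless on the window: the argument
      is nonnegative there, as shown in \<open>near\<close>.\<close>
    define cnt where "cnt m i = (if snd i then nat (int (m (fst i)) + z $ fst i) else m (fst i))"
      for m :: "'d \<Rightarrow> nat" and i
    define W where "W = cnt ` (PiE UNIV Mj)"
    have near: "\<bar>real (cnt m (j, bb)) - l (j, bb)\<bar> \<le> 3 * u \<and>
       (bb \<longrightarrow> int (cnt m (j, bb)) = int (m j) + z $ j)"
      if "m \<in> PiE UNIV Mj" for m j bb
    proof -
      have m: "l (j, False) \<le> m j" "m j \<le> l (j, False) + u"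
        using that by (auto simp: PiE_def Pi_def Mj_def)
      have mz: "m j + real_of_int (z $ j) - l (j, True) = (m j - l (j, False)) + D j"
        by (simp add: D_def)
      show ?thesis
      proof (cases bb)
        case True
        have "0 \<le> m j + real_of_int (z $ j)"
          using mz m D[of j] l_ge[of "(j, True)"] ku by linarith
        then have nn: "0 \<le> int (m j) + z $ j" by linarith
        then have "real (cnt m (j, True)) = m j + real_of_int (z $ j)"
          by (simp add: cnt_def)
        then show ?thesis using True mz m D[of j] nn by (simp add: cnt_def)
      next
        case False
        then show ?thesis using m u by (simp add: cnt_def)
      qed
    qed
    have inj: "inj_on cnt (PiE UNIV Mj)"
    proof (rule inj_onI, rule ext)
      fix m m' :: "'d \<Rightarrow> nat" and j assume "cnt m = cnt m'"
      then have "cnt m (j, False) = cnt m' (j, False)" by simp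
      then show "m j = m' j" by (simp add: cnt_def)
    qed
    have fin: "finite (PiE UNIV Mj)" by (rule finite_PiE) (auto simp: Mj_fin)
    have "W \<subseteq> step_counts z"
      unfolding W_def step_counts_def using near by (auto simp: cnt_def)
    have dens: "b / u \<le> exp (- l i) * l i ^ cnt m i / fact (cnt m i)"
      if "m \<in> PiE UNIV Mj" for m i
    proof -
      obtain j bb where i: "i = (j, bb)" by (metis surj_pair)
      have n: "\<bar>real (cnt m i) - l i\<bar> \<le> 3 * u" using near[OF that] i by blast
      have n1: "1 \<le> real (cnt m i)" using n l_ge[of i] ku by linarith
      have "real (cnt m i) \<le> t + 3 * u" using n l_le[of i] by linarith
      also have "\<dots> \<le> 4 * t" using u mult_right_mono[of 1 u u] by (simp add: tu)
      finally have "sqrt (cnt m i) \<le> sqrt (4 * t)" by simp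
      then have sq: "sqrt (cnt m i) \<le> 2 * u" by (simp add: real_sqrt_mult u_def)
      have "(real (cnt m i) - l i)\<^sup>2 \<le> (3 * u)\<^sup>2"
        using power_mono[OF n, of 2] by simp
      also have "\<dots> = 9 / k * (k * t)" using \<open>0 < k\<close> by (simp add: tu power2_eq_square)
      also have "\<dots> \<le> 9 / k * l i" using \<open>0 < k\<close> l_ge[of i] by (intro mult_left_mono) auto
      finally have "(real (cnt m i) - l i)\<^sup>2 / l i \<le> 9 / k" using l_pos[of i] by (simp add: field_simps)
      then have e: "exp (- (9 / k)) \<le> exp (- (real (cnt m i) - l i)\<^sup>2 / l i)" by simp
      have "b / u = exp (- (9 / k)) / (exp 1 * (2 * u))" by (simp add: b_def)
      also have "\<dots> \<le> exp (- (real (cnt m i) - l i)\<^sup>2 / l i) / (exp 1 * sqrt (cnt m i))"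
        using e sq n1 by (intro frac_le) auto
      also have "\<dots> \<le> exp (- l i) * l i ^ cnt m i / fact (cnt m i)"
        using n1 by (intro poisson_density_ge l_pos) auto
      finally show ?thesis .
    qed
    have card_i: "card (UNIV :: ('d \<times> bool) set) = 2 * CARD('d)" by simp
    have "c / sqrt r ^ CARD('d) = (u / 2) ^ CARD('d) * (b / u) ^ (2 * CARD('d))"
    proof -
      have "sqrt r = sqrt a * u" using assms by (simp add: u_def t_def real_sqrt_divide)
      then have "c / sqrt r ^ CARD('d) = ((b\<^sup>2 / 2) / u) ^ CARD('d)"
        using assms u by (simp add: c_def power_mult_distrib power_divide)
      also have "(b\<^sup>2 / 2) / u = (u / 2) * (b / u)\<^sup>2" using u by (simp add: field_simps power2_eq_square)
      finally show ?thesis by (simp only: power_mult_distrib power_mult)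
    qed
    also have "\<dots> \<le> card (PiE UNIV Mj) * (b / u) ^ (2 * CARD('d))"
    proof (rule mult_right_mono)
      have "(u / 2) ^ CARD('d) = (\<Prod>j\<in>(UNIV::'d set). u / 2)" by simp
      also have "\<dots> \<le> (\<Prod>j\<in>(UNIV::'d set). real (card (Mj j)))"
        using Mj_card u by (intro prod_mono) auto
      finally show "(u / 2) ^ CARD('d) \<le> card (PiE UNIV Mj)" by (simp add: card_PiE)
    qed (use \<open>0 < b\<close> u in simp)
    also have "\<dots> = (\<Sum>m\<in>PiE UNIV Mj. \<Prod>i\<in>(UNIV::('d \<times> bool) set). b / u)"
      by (simp add: card_i mult.commute)
    also have "\<dots> \<le> (\<Sum>m\<in>PiE UNIV Mj. \<Prod>i\<in>UNIV. exp (- l i) * l i ^ cnt m i / fact (cnt m i))"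
          proof (intro sum_mono prod_mono conjI)
      show "0 \<le> b / u" using \<open>0 < b\<close> u by simp
    qed (rule dens)
    also have "\<dots> = (\<Sum>n\<in>W. \<Prod>i\<in>UNIV. exp (- l i) * l i ^ n i / fact (n i))"
      unfolding W_def by (simp add: sum.reindex[OF inj])
    also have "\<dots> \<le> H z"
    proof -
      have "finite W" using fin by (simp add: W_def)
      from sum_poisson_product_le[OF _ this \<open>W \<subseteq> step_counts z\<close>, of t] \<open>16 \<le> t\<close>
      show ?thesis by (simp add: l_def)
    qed
    finally show ?thesis .
  qed
  then have "\<forall>z r. r1 \<le> r \<longrightarrow> z $ j1 = int r \<longrightarrow>
    (\<forall>j. j \<noteq> j1 \<longrightarrow> \<bar>real_of_int (z $ j)\<bar> \<le> 2 * sqrt r) \<longrightarrow> c / sqrt r ^ CARD('d) \<le> H z"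
    by metis
  with \<open>0 < c\<close> show ?thesis by (intro exI[of _ c] conjI exI[of _ r1])
qed

end

section \<open>Independence of the driving randomness\<close>

text \<open>The empty sum is allowed, so the starting point counts as hit; this yields
  \<open>H 0 = 1\<close>.\<close>

definition hits :: "(nat \<Rightarrow> int ^ 'd::finite) \<Rightarrow> int ^ 'd \<Rightarrow> bool" where
  "hits s z \<longleftrightarrow> (\<exists>k. (\<Sum>l<k. s l) = z)"

lemma hits_0: "hits s 0"
  unfolding hits_def by (intro exI[of _ 0]) simp

lemma hits_shift:
  assumes "hits (\<lambda>n. s (Suc n)) (z - s 0)"
  shows "hits s z"
proof -
  obtain k where k: "(\<Sum>l<k. s (Suc l)) = z - s 0" using assms by (auto simp: hits_def)
  have "(\<Sum>l<Suc k. s l) = z" using k by (simp only: sum.lessThan_Suc_shift) simp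
  then show ?thesis unfolding hits_def by blast
qed

lemma measurable_sum_countable:
  fixes f :: "'b \<Rightarrow> 'a \<Rightarrow> 'c::{countable, comm_monoid_add}"
  assumes "\<And>i. i \<in> I \<Longrightarrow> f i \<in> measurable M (count_space UNIV)"
  shows "(\<lambda>x. \<Sum>i\<in>I. f i x) \<in> measurable M (count_space UNIV)"
  using assms
proof (induction I rule: infinite_finite_induct)
  case (insert i I)
  have *: "f i \<in> measurable M (count_space UNIV)"
    "(\<lambda>x. \<Sum>i\<in>I. f i x) \<in> measurable M (count_space UNIV)"
    using insert by auto
  have "(\<lambda>x. a + (\<Sum>i\<in>I. f i x)) \<in> measurable M (count_space UNIV)" for a
    by (rule measurable_compose[OF *(2)]) simp
  from measurable_compose_countable[OF this *(1)] show ?case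
    using insert by simp
qed simp_all

lemma pred_hits:
  assumes [measurable]: "\<And>l. (\<lambda>\<omega>. s \<omega> l) \<in> measurable M (count_space UNIV)"
  shows "Measurable.pred M (\<lambda>\<omega>. hits (s \<omega>) z)"
proof -
  have [measurable]: "(\<lambda>\<omega>. \<Sum>l<k. s \<omega> l) \<in> measurable M (count_space UNIV)" for k
    by (intro measurable_sum_countable assms)
  show ?thesis unfolding hits_def by measurable
qed

text \<open>This is how a random index is handled. The first \<open>i\<close> whose
  \<open>A i\<close> occurs is determined by \<open>F\<close>, so for this very \<open>i\<close> the
  event \<open>B i\<close> still has conditional probability at least \<open>c\<close>; summing over
  the disjoint choices gives the bound.\<close>

lemma (in prob_space) prob_sub_sigma_select:
  fixes A B :: "'i::countable \<Rightarrow> 'a set"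
  assumes indep: "\<And>C D. C \<in> sets F \<Longrightarrow> D \<in> sets G \<Longrightarrow> prob (C \<inter> D) = prob C * prob D"
    and F: "sets F \<subseteq> events" and G: "sets G \<subseteq> events"
    and A: "\<And>i. A i \<in> sets F" and B: "\<And>i. B i \<in> sets G" and c: "\<And>i. c \<le> prob (B i)"
  shows "c * prob (\<Union>i. A i) \<le> prob (\<Union>i. A i \<inter> B i)"
proof -
  \<comment> \<open>Numbers that code no index get the empty set, so the arbitrary values of
    \<open>from_nat\<close> there do no harm.\<close>
  define A' where "A' n = (if n \<in> range (to_nat :: 'i \<Rightarrow> nat) then A (from_nat n) else {})" for n
  define B' where "B' n = B (from_nat n)" for n
  have A': "A' n \<in> sets F" and B': "B' n \<in> sets G" for n
    using A B by (auto simp: A'_def B'_def)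
  have D: "disjointed A' n \<in> sets F" for n
    using sets.range_disjointed_sets[of A' F] A' by auto
  have UA: "(\<Union>n. A' n) = (\<Union>i. A i)"
  proof (intro antisym UN_least)
    show "A' n \<subseteq> (\<Union>i. A i)" for n by (auto simp: A'_def)
    show "A i \<subseteq> (\<Union>n. A' n)" for i
      by (rule order_trans[OF _ UN_upper[of "to_nat i"]]) (auto simp: A'_def)
  qed
  have D_ev: "disjointed A' n \<in> events" and B_ev: "B' n \<in> events" for n
    using D B' F G by auto
  have dis: "disjoint_family (disjointed A')" by (rule disjoint_family_disjointed)
  have s1: "(\<lambda>n. prob (disjointed A' n)) sums prob (\<Union>i. A i)"
    using finite_measure_UNION[OF _ dis] D_ev by (simp add: UN_disjointed_eq UA image_subset_iff)
  have s2: "(\<lambda>n. prob (disjointed A' n \<inter> B' n)) sums prob (\<Union>n. disjointed A' n \<inter> B' n)"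
  proof (rule finite_measure_UNION)
    show "disjoint_family (\<lambda>n. disjointed A' n \<inter> B' n)"
      using dis unfolding disjoint_family_on_def by blast
  qed (use D_ev B_ev in auto)
  have "c * prob (\<Union>i. A i) \<le> prob (\<Union>n. disjointed A' n \<inter> B' n)"
  proof (rule sums_le[OF _ sums_mult[OF s1] s2])
    fix n
    show "c * prob (disjointed A' n) \<le> prob (disjointed A' n \<inter> B' n)"
      using indep[OF D B', of n n] c[of "from_nat n"] unfolding B'_def
      by (simp add: mult.commute[of c] mult_left_mono)
  qed
  also have "\<dots> \<le> prob (\<Union>i. A i \<inter> B i)"
  proof (rule finite_measure_mono)
    show "(\<Union>n. disjointed A' n \<inter> B' n) \<subseteq> (\<Union>i. A i \<inter> B i)"
    proof
      fix \<omega> assume "\<omega> \<in> (\<Union>n. disjointed A' n \<inter> B' n)"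
      then obtain n where "\<omega> \<in> A' n" "\<omega> \<in> B' n"
        using disjointed_subset[of A'] by blast
      then show "\<omega> \<in> (\<Union>i. A i \<inter> B i)" by (auto simp: A'_def B'_def split: if_splits)
    qed
    show "(\<Union>i. A i \<inter> B i) \<in> events" using A B F G by blast
  qed
  finally show ?thesis .
qed

lemma prod_one_minus_le_exp:
  fixes x :: "'a \<Rightarrow> real"
  assumes "\<And>i. i \<in> I \<Longrightarrow> x i \<le> 1"
  shows "(\<Prod>i\<in>I. 1 - x i) \<le> exp (- (\<Sum>i\<in>I. x i))"
proof (cases "finite I")
  case True
  have "(\<Prod>i\<in>I. 1 - x i) \<le> (\<Prod>i\<in>I. exp (- x i))"
    using assms exp_ge_add_one_self[of "- x i" for i] by (intro prod_mono) auto
  then show ?thesis using True by (simp add: exp_sum sum_negf[symmetric])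
\<comment> \<open>For infinite \<open>I\<close> both sides are 1 by convention.\<close>
qed simp

text \<open>A coordinate of the randomness: \<open>Inl x\<close> is the number of frogs at
  \<open>x\<close>, \<open>Inr (f, k)\<close> the increment \<open>k\<close> of the frog
  \<open>f\<close>.\<close>

type_synonym 'd coord = "(int ^ 'd) + 'd frog \<times> nat"

section \<open>The law of one path and its hitting probabilities\<close>

locale frog_model =
  fixes p :: "(int ^ 'd::finite) pmf" and \<mu> :: "nat pmf"
  assumes p_pos: "\<And>e. e \<in> unit_steps \<Longrightarrow> 0 < pmf p e"
    and p_sum: "(\<Sum>e\<in>unit_steps. pmf p e) = 1"
begin

definition path_measure :: "(nat \<Rightarrow> int ^ 'd) measure" where
  "path_measure = PiM UNIV (\<lambda>_. measure_pmf p)"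

lemma prob_space_path_measure: "prob_space path_measure"
  unfolding path_measure_def by (intro prob_space_PiM measure_pmf.prob_space_axioms)

lemma space_path_measure [simp]: "space path_measure = UNIV"
  by (simp add: path_measure_def space_PiM)

lemma measurable_path_nth [measurable]: "(\<lambda>s. s l) \<in> measurable path_measure (count_space UNIV)"
proof -
  have "(\<lambda>s. s l) \<in> measurable path_measure (measure_pmf p)"
    unfolding path_measure_def by measurable
  then show ?thesis by simp
qed

lemma pred_path_hits [measurable]: "Measurable.pred path_measure (\<lambda>s. hits s z)"
  by (rule pred_hits) measurable

lemma measurable_path_shift:
  "(\<lambda>s n. s (n + k)) \<in> measurable path_measure path_measure"
proof -
  have "(\<lambda>s n. s (n + k)) \<in> measurable path_measure (PiM UNIV (\<lambda>_. measure_pmf p))"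
    by (rule measurable_PiM_single')
      (auto simp: path_measure_def intro: measurable_path_nth[unfolded path_measure_def])
  then show ?thesis by (simp add: path_measure_def)
qed

text \<open>The Markov property at time 1: prepending an independent step to a path reproduces the
  path law.\<close>

lemma path_first_step:
  assumes A [measurable]: "A \<in> sets path_measure"
  shows "measure path_measure {s. s 0 = e \<and> (\<lambda>n. s (Suc n)) \<in> A} = pmf p e * measure path_measure A"
proof -
  interpret S: sequence_space "measure_pmf p" ..
  interpret prob_space path_measure by (rule prob_space_path_measure)
  let ?X = "{s. s 0 = e \<and> (\<lambda>n. s (Suc n)) \<in> A}"
  let ?f = "\<lambda>(x, s). case_nat x s :: nat \<Rightarrow> int ^ 'd"
  note measurable_path_shift [measurable]
  have "{s \<in> space path_measure. s 0 = e \<and> (\<lambda>n. s (n + 1)) \<in> A} \<in> sets path_measure"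
    by measurable
  then have X: "?X \<in> sets path_measure" by simp
  have f: "?f \<in> measurable (measure_pmf p \<Otimes>\<^sub>M path_measure) path_measure"
    unfolding path_measure_def by measurable
  have "emeasure path_measure ?X = emeasure (distr (measure_pmf p \<Otimes>\<^sub>M path_measure) path_measure ?f) ?X"
    using S.PiM_iter by (simp add: path_measure_def)
  also have "\<dots> = emeasure (measure_pmf p \<Otimes>\<^sub>M path_measure) (?f -` ?X \<inter> space (measure_pmf p \<Otimes>\<^sub>M path_measure))"
    by (rule emeasure_distr[OF f X])
  also have "?f -` ?X \<inter> space (measure_pmf p \<Otimes>\<^sub>M path_measure) = {e} \<times> A"
    by (auto simp: space_pair_measure)
  also have "emeasure (measure_pmf p \<Otimes>\<^sub>M path_measure) ({e} \<times> A) = emeasure p {e} * emeasure path_measure A"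
    using A by (intro emeasure_pair_measure_Times) auto
  finally show ?thesis
    by (simp add: measure_def emeasure_pmf_single enn2real_mult)
qed

definition q :: "'d \<times> bool \<Rightarrow> real" where "q i = pmf p (step i)"

definition H :: "int ^ 'd \<Rightarrow> real" where "H z = measure path_measure {s. hits s z}"

lemma step_in: "step i \<in> unit_steps"
  using range_step by blast

text \<open>Different first steps give disjoint events, and a hit of \<open>z - step i\<close> by
  the path after the first step \<open>step i\<close> is a hit of \<open>z\<close> by the whole
  path.\<close>

sublocale superharmonic q H
proof
  interpret prob_space path_measure by (rule prob_space_path_measure)
  show "0 < q i" for i unfolding q_def by (intro p_pos step_in)
  show "(\<Sum>i\<in>UNIV. q i) = 1"
    using p_sum unfolding q_def range_step[symmetric] by (simp add: sum.reindex[OF inj_step])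
  show "0 \<le> H z" for z by (simp add: H_def)
  show "H 0 = 1" using prob_space by (simp add: H_def hits_0)
  show "(\<Sum>i\<in>UNIV. q i * H (z - step i)) \<le> H z" for z
  proof -
    note measurable_path_shift [measurable]
    have hit_set [measurable]: "{s. hits s z'} \<in> events" for z'
      using pred_path_hits[of z'] by (simp add: pred_def)
    let ?X = "\<lambda>i. {s. s 0 = step i \<and> (\<lambda>n. s (Suc n)) \<in> {s. hits s (z - step i)}}"
    have "(\<Sum>i\<in>UNIV. q i * H (z - step i)) = (\<Sum>i\<in>UNIV. prob (?X i))"
      unfolding q_def H_def by (intro sum.cong refl path_first_step[symmetric] hit_set)
    also have "\<dots> = prob (\<Union>i\<in>UNIV. ?X i)"
    proof (rule finite_measure_finite_Union[symmetric])
      show "?X ` UNIV \<subseteq> events"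
      proof safe
        fix i
        have "{s \<in> space path_measure. s 0 = step i \<and> (\<lambda>n. s (n + 1)) \<in> {s. hits s (z - step i)}} \<in> events"
          by measurable
        then show "?X i \<in> events" by simp
      qed
      show "disjoint_family ?X"
        by (auto simp: disjoint_family_on_def dest: injD[OF inj_step])
    qed simp
    also have "\<dots> \<le> H z"
      unfolding H_def by (intro finite_measure_mono hit_set) (auto intro: hits_shift)
    finally show ?thesis .
  qed
qed

lemma H_pos: "0 < H z"
proof -
  obtain c where "0 < c" "\<And>i. c \<le> q i" using ex_q_lower_bound by blast
  then have "c ^ nat (\<Sum>j\<in>UNIV. \<bar>z $ j\<bar>) \<le> H z"
    by (intro H_ge_power) (auto simp: sum_nonneg)
  then show ?thesis using \<open>0 < c\<close> by (meson less_le_trans zero_less_power)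
qed

text \<open>If a path has no such run, neither has its shift by \<open>L\<close>.  But the event that the shifted path
  has no run also contains, with positive conditional probability, a run in the first \<open>L\<close> steps.\<close>

lemma AE_path_run:
  assumes "e \<in> unit_steps"
  shows "AE s in path_measure. \<exists>k. \<forall>i<L. s (k + i) = e"
proof -
  interpret prob_space path_measure by (rule prob_space_path_measure)
  define N where "N = {s :: nat \<Rightarrow> int ^ 'd. \<not> (\<exists>k. \<forall>i<L. s (k + i) = e)}"
  have "{s \<in> space path_measure. \<not> (\<exists>k. \<forall>i<L. s (k + i) = e)} \<in> events" by measurable
  then have N [measurable]: "N \<in> events" by (simp add: N_def)
  have sh_ev: "{s. (\<forall>i<m. s i = e) \<and> (\<lambda>n. s (n + l)) \<in> N} \<in> events" for m l
  proof -
    note measurable_path_shift [measurable]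
    have "{s \<in> space path_measure. (\<forall>i<m. s i = e) \<and> (\<lambda>n. s (n + l)) \<in> N} \<in> events"
      by measurable
    then show ?thesis by simp
  qed
  have run: "prob {s. (\<forall>i<m. s i = e) \<and> (\<lambda>n. s (n + m)) \<in> N} = pmf p e ^ m * prob N" for m
  proof (induction m)
    case (Suc m)
    have eq: "{s. (\<forall>i<Suc m. s i = e) \<and> (\<lambda>n. s (n + Suc m)) \<in> N}
      = {s. s 0 = e \<and> (\<lambda>n. s (Suc n)) \<in> {s. (\<forall>i<m. s i = e) \<and> (\<lambda>n. s (n + m)) \<in> N}}"
      by (auto simp: less_Suc_eq_0_disj)
    show ?case unfolding eq path_first_step[OF sh_ev] Suc by simp
  qed simp
  have shift: "prob {s. (\<lambda>n. s (n + m)) \<in> N} = prob N" for m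
  proof -
    have "distr path_measure path_measure (\<lambda>s. \<lambda>n\<in>UNIV. s (n + m)) = path_measure"
      unfolding path_measure_def
      using distr_PiM_reindex[of UNIV "\<lambda>_. measure_pmf p" "\<lambda>n::nat. n + m" UNIV]
      by (auto simp: measure_pmf.prob_space_axioms)
    then have "prob N = measure (distr path_measure path_measure (\<lambda>s n. s (n + m))) N"
      by (simp add: restrict_UNIV)
    also have "\<dots> = prob ((\<lambda>s n. s (n + m)) -` N \<inter> space path_measure)"
      using N by (intro measure_distr measurable_path_shift)
    finally show ?thesis by (simp add: vimage_def)
  qed
  let ?C = "{s. (\<forall>i<L. s i = e) \<and> (\<lambda>n. s (n + L)) \<in> N}"
  have "prob N + prob ?C = prob (N \<union> ?C)"
  proof (rule finite_measure_Union[symmetric])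
    show "N \<inter> ?C = {}"
      unfolding N_def by (auto dest: spec[of _ 0])
  qed (use N sh_ev[of L L] in auto)
  also have "\<dots> \<le> prob {s. (\<lambda>n. s (n + L)) \<in> N}"
  proof (rule finite_measure_mono)
    show "N \<union> ?C \<subseteq> {s. (\<lambda>n. s (n + L)) \<in> N}"
    proof safe
      fix s assume s: "s \<in> N"
      show "(\<lambda>n. s (n + L)) \<in> N"
        unfolding N_def
      proof safe
        fix k assume "\<forall>i<L. s (k + i + L) = e"
        then have "\<forall>i<L. s ((k + L) + i) = e" by (simp add: ac_simps)
        then show False using s unfolding N_def by blast
      qed
    qed
    show "{s. (\<lambda>n. s (n + L)) \<in> N} \<in> events" using sh_ev[of 0 L] by simp
  qed
  finally have "pmf p e ^ L * prob N \<le> 0" using run[of L] shift[of L] by simp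
  then have "prob N = 0"
    using p_pos[OF assms] by (simp add: mult_le_0_iff measure_le_0_iff) (metis less_irrefl linorder_not_less zero_less_power)
  then have "AE s in path_measure. s \<notin> N" using N by (simp add: prob_eq_0)
  then show ?thesis by (simp add: N_def)
qed

section \<open>The product space and its independent coordinates\<close>

definition M :: "((int ^ 'd \<Rightarrow> nat) \<times> ('d frog \<times> nat \<Rightarrow> int ^ 'd)) measure" where
  "M = iid_config \<mu> \<Otimes>\<^sub>M increments p"

lemma prob_space_config: "prob_space (iid_config \<mu> :: (int ^ 'd \<Rightarrow> nat) measure)"
  unfolding iid_config_def by (intro prob_space_PiM measure_pmf.prob_space_axioms)

lemma prob_space_increments: "prob_space (increments p)"
  unfolding increments_def by (intro prob_space_PiM measure_pmf.prob_space_axioms)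

lemma prob_space_M: "prob_space M"
  unfolding M_def using prob_space_config prob_space_increments
  by (intro prob_space_pair)

sublocale M: prob_space M by (rule prob_space_M)

lemma measurable_config [measurable]:
  assumes "x \<noteq> 0" shows "(\<lambda>\<omega>. fst \<omega> x) \<in> measurable M (count_space UNIV)"
proof -
  have "(\<lambda>\<eta>. \<eta> x) \<in> measurable (iid_config \<mu>) (measure_pmf \<mu>)"
    unfolding iid_config_def using assms by (intro measurable_component_singleton) simp
  moreover have "fst \<in> measurable M (iid_config \<mu>)" unfolding M_def by (rule measurable_fst)
  ultimately have "(\<lambda>\<omega>. fst \<omega> x) \<in> measurable M (measure_pmf \<mu>)" by (rule measurable_compose[rotated])
  then show ?thesis by simp
qed

lemma measurable_increment [measurable]: "(\<lambda>\<omega>. snd \<omega> i) \<in> measurable M (count_space UNIV)"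
proof -
  have "(\<lambda>\<xi>. \<xi> i) \<in> measurable (increments p) (measure_pmf p)"
    unfolding increments_def by (intro measurable_component_singleton) simp
  moreover have "snd \<in> measurable M (increments p)" unfolding M_def by (rule measurable_snd)
  ultimately have "(\<lambda>\<omega>. snd \<omega> i) \<in> measurable M (measure_pmf p)" by (rule measurable_compose[rotated])
  then show ?thesis by (simp only: measurable_pmf_measure2)
qed

definition coord_sets :: "'d coord \<Rightarrow> ((int ^ 'd \<Rightarrow> nat) \<times> ('d frog \<times> nat \<Rightarrow> int ^ 'd)) set set" where
  "coord_sets c = (case c of
     Inl x \<Rightarrow> {{\<omega> \<in> space M. fst \<omega> x \<in> A} |A. True}
   | Inr i \<Rightarrow> {{\<omega> \<in> space M. snd \<omega> i \<in> A} |A. True})"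

text \<open>The site \<open>0\<close> carries no coordinate of the configuration.\<close>

definition coords :: "'d coord set" where "coords = - {Inl 0}"

lemma coord_sets_events: "c \<in> coords \<Longrightarrow> coord_sets c \<subseteq> M.events"
  unfolding coord_sets_def coords_def by (auto split: sum.splits)

lemma Int_stable_coord_sets: "Int_stable (coord_sets c)"
proof (rule Int_stableI)
  fix a b assume ab: "a \<in> coord_sets c" "b \<in> coord_sets c"
  show "a \<inter> b \<in> coord_sets c"
  proof (cases c)
    case (Inl x)
    then obtain A B where "a = {\<omega> \<in> space M. fst \<omega> x \<in> A}" "b = {\<omega> \<in> space M. fst \<omega> x \<in> B}"
      using ab by (auto simp: coord_sets_def)
    then have "a \<inter> b = {\<omega> \<in> space M. fst \<omega> x \<in> A \<inter> B}" by auto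
    then show ?thesis unfolding coord_sets_def Inl sum.case by blast
  next
    case (Inr i)
    then obtain A B where "a = {\<omega> \<in> space M. snd \<omega> i \<in> A}" "b = {\<omega> \<in> space M. snd \<omega> i \<in> B}"
      using ab by (auto simp: coord_sets_def)
    then have "a \<inter> b = {\<omega> \<in> space M. snd \<omega> i \<in> A \<inter> B}" by auto
    then show ?thesis unfolding coord_sets_def Inr sum.case by blast
  qed
qed

lemma prob_cylinder:
  assumes "finite J" "0 \<notin> J" "finite K"
  shows "M.prob {\<omega> \<in> space M. (\<forall>x\<in>J. fst \<omega> x \<in> A x) \<and> (\<forall>i\<in>K. snd \<omega> i \<in> B i)}
    = (\<Prod>x\<in>J. measure \<mu> (A x)) * (\<Prod>i\<in>K. measure p (B i))"
proof -
  interpret E: product_prob_space "\<lambda>_. measure_pmf \<mu>" "UNIV - {0 :: int ^ 'd}" ..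
  interpret X: product_prob_space "\<lambda>_. measure_pmf p" "UNIV :: ('d frog \<times> nat) set" ..
  interpret I: prob_space "increments p" by (rule prob_space_increments)
  let ?A = "{\<eta> \<in> space (iid_config \<mu>). \<forall>x\<in>J. \<eta> x \<in> A x}"
  let ?B = "{\<xi> \<in> space (increments p). \<forall>i\<in>K. \<xi> i \<in> B i}"
  have J: "J \<subseteq> UNIV - {0}" using assms by auto
  have "?A \<in> sets (iid_config \<mu>)"
    unfolding iid_config_def using J assms(1)
    by (intro sets.sets_Collect_finite_All sets_Collect_single') auto
  moreover have "?B \<in> sets (increments p)"
    unfolding increments_def using assms(3)
    by (intro sets.sets_Collect_finite_All sets_Collect_single') auto
  ultimately have "emeasure M (?A \<times> ?B) = emeasure (iid_config \<mu>) ?A * emeasure (increments p) ?B"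
    unfolding M_def by (rule I.emeasure_pair_measure_Times)
  also have "emeasure (iid_config \<mu>) ?A = (\<Prod>x\<in>J. emeasure \<mu> (A x))"
    unfolding iid_config_def using J assms(1) by (intro E.emeasure_PiM_Collect) auto
  also have "emeasure (increments p) ?B = (\<Prod>i\<in>K. emeasure p (B i))"
    unfolding increments_def using assms(3) by (intro X.emeasure_PiM_Collect) auto
  also have "?A \<times> ?B = {\<omega> \<in> space M. (\<forall>x\<in>J. fst \<omega> x \<in> A x) \<and> (\<forall>i\<in>K. snd \<omega> i \<in> B i)}"
    by (auto simp: M_def space_pair_measure)
  finally show ?thesis
    by (simp add: M.emeasure_eq_measure measure_pmf.emeasure_eq_measure prod_ennreal prod_nonneg
        flip: ennreal_mult)
qed

lemma indep_coord_sets: "M.indep_sets coord_sets coords"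
proof (rule M.indep_setsI)
  fix S J assume J: "J \<noteq> {}" "J \<subseteq> coords" "finite J" and S: "\<forall>c\<in>J. S c \<in> coord_sets c"
  define JL where "JL = {x. Inl x \<in> J}"
  define JR where "JR = {i. Inr i \<in> J}"
  have J_eq: "J = Inl ` JL \<union> Inr ` JR"
  proof (rule set_eqI)
    show "c \<in> J \<longleftrightarrow> c \<in> Inl ` JL \<union> Inr ` JR" for c
      by (cases c) (auto simp: JL_def JR_def)
  qed
  have fin: "finite JL" "finite JR"
    using finite_vimageI[OF J(3), of Inl] finite_vimageI[OF J(3), of Inr]
    by (simp_all add: JL_def JR_def vimage_def)
  have "0 \<notin> JL" using J by (auto simp: JL_def coords_def)
  have "\<exists>A. S (Inl x) = {\<omega> \<in> space M. fst \<omega> x \<in> A}" if "x \<in> JL" for x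
    using S that by (auto simp: JL_def coord_sets_def dest!: bspec[of _ _ "Inl x"])
  then have "\<forall>x\<in>JL. \<exists>A. S (Inl x) = {\<omega> \<in> space M. fst \<omega> x \<in> A}" by (rule ballI)
  from bchoice[OF this] obtain A where A: "\<forall>x\<in>JL. S (Inl x) = {\<omega> \<in> space M. fst \<omega> x \<in> A x}" ..
  have "\<exists>A. S (Inr i) = {\<omega> \<in> space M. snd \<omega> i \<in> A}" if "i \<in> JR" for i
    using S that by (auto simp: JR_def coord_sets_def dest!: bspec[of _ _ "Inr i"])
  then have "\<forall>i\<in>JR. \<exists>A. S (Inr i) = {\<omega> \<in> space M. snd \<omega> i \<in> A}" by (rule ballI)
  from bchoice[OF this] obtain B where B: "\<forall>i\<in>JR. S (Inr i) = {\<omega> \<in> space M. snd \<omega> i \<in> B i}" ..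
  have "(\<Inter>c\<in>J. S c) = {\<omega> \<in> space M. (\<forall>x\<in>JL. fst \<omega> x \<in> A x) \<and> (\<forall>i\<in>JR. snd \<omega> i \<in> B i)}"
  proof (rule set_eqI)
    fix \<omega>
    have "\<omega> \<in> (\<Inter>c\<in>J. S c) \<longleftrightarrow> (\<forall>x\<in>JL. \<omega> \<in> S (Inl x)) \<and> (\<forall>i\<in>JR. \<omega> \<in> S (Inr i))"
      unfolding J_eq by blast
    also have "(\<forall>x\<in>JL. \<omega> \<in> S (Inl x)) \<longleftrightarrow> (\<forall>x\<in>JL. \<omega> \<in> space M \<and> fst \<omega> x \<in> A x)"
      using A by (intro ball_cong) auto
    also have "(\<forall>i\<in>JR. \<omega> \<in> S (Inr i)) \<longleftrightarrow> (\<forall>i\<in>JR. \<omega> \<in> space M \<and> snd \<omega> i \<in> B i)"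
      using B by (intro ball_cong) auto
    finally show "\<omega> \<in> (\<Inter>c\<in>J. S c)
        \<longleftrightarrow> \<omega> \<in> {\<omega> \<in> space M. (\<forall>x\<in>JL. fst \<omega> x \<in> A x) \<and> (\<forall>i\<in>JR. snd \<omega> i \<in> B i)}"
      using J(1) unfolding J_eq by blast
  qed
  then have "M.prob (\<Inter>c\<in>J. S c) = (\<Prod>x\<in>JL. measure \<mu> (A x)) * (\<Prod>i\<in>JR. measure p (B i))"
    using fin \<open>0 \<notin> JL\<close> by (simp add: prob_cylinder)
  moreover have "M.prob (S (Inl x)) = measure \<mu> (A x)" if "x \<in> JL" for x
    using prob_cylinder[of "{x}" "{}" A] that \<open>0 \<notin> JL\<close> A by auto
  moreover have "M.prob (S (Inr i)) = measure p (B i)" if "i \<in> JR" for i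
    using prob_cylinder[of "{}" "{i}" _ B] that B by simp
  moreover have "(\<Prod>c\<in>J. M.prob (S c)) = (\<Prod>x\<in>JL. M.prob (S (Inl x))) * (\<Prod>i\<in>JR. M.prob (S (Inr i)))"
    unfolding J_eq using fin by (subst prod.union_disjoint) (auto simp: prod.reindex)
  ultimately show "M.prob (\<Inter>c\<in>J. S c) = (\<Prod>c\<in>J. M.prob (S c))" by simp
qed (rule coord_sets_events)

text \<open>The sigma-algebra of the events that depend only on coordinates in \<open>J\<close>.
  Packing it as a measure lets \<open>Measurable.pred (F J)\<close> express this dependence;
  probabilities are always those of \<open>M\<close>.\<close>

definition F :: "'d coord set \<Rightarrow> ((int ^ 'd \<Rightarrow> nat) \<times> ('d frog \<times> nat \<Rightarrow> int ^ 'd)) measure" where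
  "F J = sigma (space M) (\<Union>c\<in>J. coord_sets c)"

lemma space_F [simp]: "space (F J) = space M"
  unfolding F_def by (rule space_measure_of) (auto simp: coord_sets_def split: sum.splits)

lemma sets_F: "sets (F J) = sigma_sets (space M) (\<Union>c\<in>J. coord_sets c)"
  unfolding F_def by (rule sets_measure_of) (auto simp: coord_sets_def split: sum.splits)

lemma sets_F_events: "J \<subseteq> coords \<Longrightarrow> sets (F J) \<subseteq> M.events"
  unfolding sets_F using coord_sets_events by (intro sets.sigma_sets_subset) blast

lemma sets_F_mono: "J \<subseteq> J' \<Longrightarrow> sets (F J) \<subseteq> sets (F J')"
  unfolding sets_F by (intro sigma_sets_mono') auto

lemma measurable_F_config:
  assumes "Inl x \<in> J" shows "(\<lambda>\<omega>. fst \<omega> x) \<in> measurable (F J) (count_space UNIV)"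
proof (rule measurableI)
  fix A :: "nat set"
  have "{\<omega> \<in> space M. fst \<omega> x \<in> A} \<in> coord_sets (Inl x)" by (auto simp: coord_sets_def)
  then have "{\<omega> \<in> space M. fst \<omega> x \<in> A} \<in> sets (F J)" using assms by (auto simp: sets_F)
  then show "(\<lambda>\<omega>. fst \<omega> x) -` A \<inter> space (F J) \<in> sets (F J)"
    by (simp add: vimage_def Int_def conj_commute)
qed simp

lemma measurable_F_increment:
  assumes "Inr i \<in> J" shows "(\<lambda>\<omega>. snd \<omega> i) \<in> measurable (F J) (count_space UNIV)"
proof (rule measurableI)
  fix A :: "(int ^ 'd) set"
  have "{\<omega> \<in> space M. snd \<omega> i \<in> A} \<in> coord_sets (Inr i)" by (auto simp: coord_sets_def)
  then have "{\<omega> \<in> space M. snd \<omega> i \<in> A} \<in> sets (F J)" using assms by (auto simp: sets_F)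
  then show "(\<lambda>\<omega>. snd \<omega> i) -` A \<inter> space (F J) \<in> sets (F J)"
    by (simp add: vimage_def Int_def conj_commute)
qed simp

lemma indep_F:
  assumes "\<And>k. k \<in> K \<Longrightarrow> J k \<subseteq> coords" "disjoint_family_on J K"
  shows "M.indep_sets (\<lambda>k. sets (F (J k))) K"
  unfolding sets_F
proof (rule M.indep_sets_collect_sigma)
  show "M.indep_sets coord_sets (\<Union>k\<in>K. J k)"
    by (rule M.indep_sets_mono_index[OF _ indep_coord_sets]) (use assms in auto)
qed (auto simp: assms Int_stable_coord_sets)

lemma prob_INT_F:
  assumes "finite K" "\<And>k. k \<in> K \<Longrightarrow> J k \<subseteq> coords" "disjoint_family_on J K"
    and "\<And>k. k \<in> K \<Longrightarrow> A k \<in> sets (F (J k))"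
  shows "M.prob {\<omega> \<in> space M. \<forall>k\<in>K. \<omega> \<in> A k} = (\<Prod>k\<in>K. M.prob (A k))"
proof (cases "K = {}")
  case False
  have "A k \<subseteq> space M" if "k \<in> K" for k
    using sets.sets_into_space[OF assms(4)[OF that]] by simp
  then have "{\<omega> \<in> space M. \<forall>k\<in>K. \<omega> \<in> A k} = (\<Inter>k\<in>K. A k)" using False by auto
  then show ?thesis
    using M.indep_setsD[OF indep_F[OF assms(2,3)], of K A] False assms(1,4) by auto
qed (simp add: M.prob_space)

lemma prob_Int_F:
  assumes "J \<subseteq> coords" "J' \<subseteq> coords" "J \<inter> J' = {}" "A \<in> sets (F J)" "B \<in> sets (F J')"
  shows "M.prob (A \<inter> B) = M.prob A * M.prob B"
proof -
  have "M.prob {\<omega> \<in> space M. \<forall>k\<in>UNIV. \<omega> \<in> (if k then A else B)}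
      = (\<Prod>k\<in>UNIV. M.prob (if k then A else B))"
    by (rule prob_INT_F[where J = "\<lambda>k. if k then J else J'"])
       (use assms in \<open>auto simp: disjoint_family_on_def split: if_splits\<close>)
  moreover have "{\<omega> \<in> space M. \<forall>k\<in>UNIV. \<omega> \<in> (if k then A else B)} = A \<inter> B"
    using sets.sets_into_space[OF assms(4)] by (auto simp: UNIV_bool)
  ultimately show ?thesis by (simp add: UNIV_bool mult.commute)
qed

text \<open>The finite form of the second Borel-Cantelli lemma. Every estimate of a failure rests on
  it: no source, no starting vertex, no frog of a vertex reaching a given point, no return.\<close>

lemma prob_avoid_F:
  assumes "finite K" "\<And>k. k \<in> K \<Longrightarrow> J k \<subseteq> coords" "disjoint_family_on J K"
    and A: "\<And>k. k \<in> K \<Longrightarrow> A k \<in> sets (F (J k))"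
  shows "M.prob {\<omega> \<in> space M. \<forall>k\<in>K. \<omega> \<notin> A k} \<le> exp (- (\<Sum>k\<in>K. M.prob (A k)))"
proof -
  have "M.prob {\<omega> \<in> space M. \<forall>k\<in>K. \<omega> \<notin> A k} = M.prob {\<omega> \<in> space M. \<forall>k\<in>K. \<omega> \<in> space M - A k}"
    by (rule arg_cong[of _ _ M.prob]) auto
  also have "\<dots> = (\<Prod>k\<in>K. M.prob (space M - A k))"
  proof (rule prob_INT_F[OF assms(1-3)])
    show "space M - A k \<in> sets (F (J k))" if "k \<in> K" for k
      using sets.Diff[OF sets.top A[OF that]] by simp
  qed
  also have "\<dots> = (\<Prod>k\<in>K. 1 - M.prob (A k))"
    using A sets_F_events assms(2) by (intro prod.cong M.prob_compl) blast+
  also have "\<dots> \<le> exp (- (\<Sum>k\<in>K. M.prob (A k)))"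
    by (rule prod_one_minus_le_exp) simp
  finally show ?thesis .
qed

lemma prob_config:
  assumes "x \<noteq> 0" shows "M.prob {\<omega> \<in> space M. fst \<omega> x \<in> A} = measure \<mu> A"
  using prob_cylinder[of "{x}" "{}" "\<lambda>_. A"] assms by simp

section \<open>The path of one frog under the joint law\<close>

definition path_of :: "'d frog \<Rightarrow> (int ^ 'd \<Rightarrow> nat) \<times> ('d frog \<times> nat \<Rightarrow> int ^ 'd) \<Rightarrow> nat \<Rightarrow> int ^ 'd" where
  "path_of f \<omega> = (\<lambda>k. snd \<omega> (f, k))"

lemma measurable_row: "path_of f \<in> measurable M path_measure"
proof -
  have "path_of f \<in> measurable M (PiM UNIV (\<lambda>_. measure_pmf p))"
    by (rule measurable_PiM_single') (auto simp: path_of_def)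
  then show ?thesis by (simp add: path_measure_def)
qed

lemma distr_row: "distr M path_measure (path_of f) = path_measure"
proof -
  interpret C: prob_space "iid_config \<mu> :: (int ^ 'd \<Rightarrow> nat) measure" by (rule prob_space_config)
  interpret I: prob_space "increments p" by (rule prob_space_increments)
  interpret CI: pair_prob_space "iid_config \<mu> :: (int ^ 'd \<Rightarrow> nat) measure" "increments p" ..
  have s: "distr M (increments p) snd = increments p"
  proof (rule measure_eqI)
    fix A assume "A \<in> sets (distr M (increments p) snd)"
    then have A: "A \<in> sets (increments p)" by simp
    have "snd -` A \<inter> space M = space (iid_config \<mu>) \<times> A"
      using sets.sets_into_space[OF A] by (auto simp: M_def space_pair_measure)
    then show "emeasure (distr M (increments p) snd) A = emeasure (increments p) A"
      using A by (simp add: emeasure_distr M_def I.emeasure_pair_measure_Times C.emeasure_space_1)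
  qed simp
  have "distr (increments p) path_measure (\<lambda>\<xi>. \<lambda>k\<in>UNIV. \<xi> (f, k)) = path_measure"
    unfolding path_measure_def increments_def
    using distr_PiM_reindex[of UNIV "\<lambda>_. measure_pmf p" "\<lambda>k::nat. (f, k)" UNIV]
    by (auto simp: measure_pmf.prob_space_axioms inj_on_def)
  then have "distr (distr M (increments p) snd) path_measure (\<lambda>\<xi> k. \<xi> (f, k)) = path_measure"
    by (simp add: s restrict_UNIV)
  moreover have "(\<lambda>\<xi> k. \<xi> (f, k)) \<in> measurable (increments p) path_measure"
    unfolding path_measure_def increments_def
    by (rule measurable_PiM_single', rule measurable_component_singleton) auto
  ultimately show ?thesis
    by (subst (asm) distr_distr) (auto simp: M_def comp_def path_of_def[abs_def])
qed

lemma prob_row: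
  assumes "B \<in> sets path_measure"
  shows "M.prob {\<omega> \<in> space M. path_of f \<omega> \<in> B} = measure path_measure B"
proof -
  have "measure (distr M path_measure (path_of f)) B = M.prob (path_of f -` B \<inter> space M)"
    by (rule measure_distr[OF measurable_row assms])
  then show ?thesis by (simp add: distr_row vimage_def Int_def conj_commute)
qed

lemma prob_row_hits: "M.prob {\<omega> \<in> space M. hits (path_of f \<omega>) z} = H z"
  using prob_row[of "{s. hits s z}" f] pred_path_hits[of z] by (simp add: H_def pred_def)

lemma AE_row:
  assumes "AE s in path_measure. P s"
  shows "AE \<omega> in M. P (path_of f \<omega>)"
  by (rule AE_distrD[OF measurable_row], subst distr_row) (rule assms)

lemma pred_F_row_hits:
  assumes "\<And>k. Inr (f, k) \<in> J"
  shows "Measurable.pred (F J) (\<lambda>\<omega>. hits (path_of f \<omega>) z)"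
  by (rule pred_hits) (auto simp: path_of_def intro: measurable_F_increment assms)

end

section \<open>The frog dynamics\<close>

definition active :: "(int ^ 'd \<Rightarrow> nat) \<Rightarrow> ('d::finite frog \<times> nat \<Rightarrow> int ^ 'd) \<Rightarrow> 'd frog \<Rightarrow> bool" where
  "active \<eta> \<xi> f \<longleftrightarrow> (\<exists>n. frog_age \<eta> \<xi> n f \<noteq> None)"

text \<open>Arrival by a step, hence \<open>Suc k\<close>, is what wakes sleeping frogs. Time is
  absent from the definition, since an active frog eventually makes every step of its path.\<close>

definition visited :: "(int ^ 'd \<Rightarrow> nat) \<Rightarrow> ('d::finite frog \<times> nat \<Rightarrow> int ^ 'd) \<Rightarrow> int ^ 'd \<Rightarrow> bool" where
  "visited \<eta> \<xi> y \<longleftrightarrow> (\<exists>g k. active \<eta> \<xi> g \<and> walk \<xi> g (Suc k) = y)"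

lemma frog_age_add:
  "frog_age \<eta> \<xi> n f = Some k \<Longrightarrow> frog_age \<eta> \<xi> (n + m) f = Some (k + m)"
  by (induction m) auto

lemma frog_age_starts_at_0:
  "frog_age \<eta> \<xi> n f = Some k \<Longrightarrow> \<exists>n0. frog_age \<eta> \<xi> n0 f = Some 0"
proof (induction n arbitrary: k)
  case 0
  then show ?case by (auto intro!: exI[of _ 0] split: if_splits)
next
  case (Suc n)
  show ?case
  proof (cases "frog_age \<eta> \<xi> n f")
    case None
    then show ?thesis using Suc.prems by (intro exI[of _ "Suc n"]) (auto split: if_splits)
  next
    case (Some k')
    then show ?thesis by (rule Suc.IH)
  qed
qed

text \<open>A frog enters with age 0 and grows older by one at each time, so no age is
  skipped.\<close>

lemma active_age:
  assumes "active \<eta> \<xi> f"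
  shows "\<exists>n. frog_age \<eta> \<xi> n f = Some k"
proof -
  obtain n0 where "frog_age \<eta> \<xi> n0 f = Some 0"
    using assms frog_age_starts_at_0 unfolding active_def by blast
  from frog_age_add[OF this, of k] show ?thesis by auto
qed

lemma active_origin: "active \<eta> \<xi> (0, 0)"
  unfolding active_def by (rule exI[of _ 0]) simp

lemma visited_imp_active:
  assumes "visited \<eta> \<xi> y" "y \<noteq> 0" "i < \<eta> y"
  shows "active \<eta> \<xi> (y, i)"
proof -
  obtain g k where "active \<eta> \<xi> g" and w: "walk \<xi> g (Suc k) = y"
    using assms by (auto simp: visited_def)
  then obtain n where n: "frog_age \<eta> \<xi> n g = Some k" using active_age by blast
  have "\<exists>g k. frog_age \<eta> \<xi> n g = Some k \<and> walk \<xi> g (Suc k) = fst (y, i)"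
    using n w by (intro exI[of _ g] exI[of _ k]) simp
  then have "frog_age \<eta> \<xi> (Suc n) (y, i) \<noteq> None"
    using assms by (auto split: option.split)
  then show ?thesis unfolding active_def by blast
qed

text \<open>\<open>z \<noteq> 0\<close> excludes the empty piece of the path, as
  \<open>visited\<close> asks for at least one step.\<close>

lemma active_imp_visited:
  assumes "active \<eta> \<xi> f" "hits (\<lambda>k. \<xi> (f, k)) z" "z \<noteq> 0"
  shows "visited \<eta> \<xi> (fst f + z)"
proof -
  obtain k where k: "(\<Sum>l<k. \<xi> (f, l)) = z" using assms by (auto simp: hits_def)
  then obtain m where "k = Suc m" using assms(3) by (cases k) auto
  then have "walk \<xi> f (Suc m) = fst f + z" using k by (simp add: walk_def)
  then show ?thesis using assms(1) unfolding visited_def by blast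
qed

lemma finite_active_at: "finite {f. frog_age \<eta> \<xi> n f \<noteq> None}"
proof (induction n)
  case (Suc n)
  let ?D = "{f. frog_age \<eta> \<xi> n f \<noteq> None}"
  let ?P = "(\<lambda>g. walk \<xi> g (Suc (the (frog_age \<eta> \<xi> n g)))) ` ?D"
  have "{f. frog_age \<eta> \<xi> (Suc n) f \<noteq> None} \<subseteq> ?D \<union> (SIGMA x:?P. {..<\<eta> x})"
    by (force split: option.splits if_splits)
  moreover have "finite (?D \<union> (SIGMA x:?P. {..<\<eta> x}))" using Suc by auto
  ultimately show ?case by (rule finite_subset)
qed auto

text \<open>At each time only finitely many frogs are active, so infinitely many frogs that pass
  through 0 at some age need infinitely many times to do so.\<close>

lemma origin_visited_infinitely_oftenI:
  assumes "infinite {f. active \<eta> \<xi> f \<and> hits (\<lambda>k. \<xi> (f, k)) (- fst f)}"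
  shows "frog_path \<eta> \<xi> \<in> origin_visited_infinitely_often"
proof -
  let ?T = "{n. \<exists>f. frog_path \<eta> \<xi> n f = Some 0}"
  let ?S = "{f. active \<eta> \<xi> f \<and> hits (\<lambda>k. \<xi> (f, k)) (- fst f)}"
  have "infinite ?T"
  proof
    assume "finite ?T"
    moreover have "?S \<subseteq> (\<Union>n\<in>?T. {f. frog_age \<eta> \<xi> n f \<noteq> None})"
    proof
      fix f assume f: "f \<in> ?S"
      then obtain k where k: "(\<Sum>l<k. \<xi> (f, l)) = - fst f" by (auto simp: hits_def)
      obtain n where n: "frog_age \<eta> \<xi> n f = Some k" using f active_age by blast
      then have "frog_path \<eta> \<xi> n f = Some 0" using k by (simp add: frog_path_def walk_def)
      then have "n \<in> ?T" by blast
      moreover have "f \<in> {f. frog_age \<eta> \<xi> n f \<noteq> None}" using n by simp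
      ultimately show "f \<in> (\<Union>n\<in>?T. {f. frog_age \<eta> \<xi> n f \<noteq> None})" by (rule UN_I)
    qed
    moreover have "finite (\<Union>n\<in>?T. {f. frog_age \<eta> \<xi> n f \<noteq> None})"
      by (rule finite_UN_I[OF \<open>finite ?T\<close> finite_active_at])
    ultimately have "finite ?S" by (blast intro: finite_subset)
    then show False using assms by simp
  qed
  then show ?thesis by (simp add: origin_visited_infinitely_often_def)
qed

context frog_model
begin

section \<open>Measurability and passage to the annealed law\<close>

lemma measurable_walk: "(\<lambda>\<omega>. walk (snd \<omega>) g k) \<in> measurable M (count_space UNIV)"
proof -
  have "(\<lambda>\<omega>. \<Sum>l<k. snd \<omega> (g, l)) \<in> measurable M (count_space UNIV)"
    by (intro measurable_sum_countable measurable_increment)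
  from measurable_compose[OF this, of "\<lambda>s. fst g + s" "count_space UNIV"]
  show ?thesis by (simp add: walk_def)
qed

lemma measurable_frog_age:
  "(\<lambda>\<omega>. frog_age (fst \<omega>) (snd \<omega>) n f) \<in> measurable M (count_space UNIV)"
proof (induction n arbitrary: f)
  case (Suc n)
  note Suc.IH [measurable] measurable_walk [measurable]
  have c: "Measurable.pred M (\<lambda>\<omega>. fst f \<noteq> 0 \<and> snd f < fst \<omega> (fst f) \<and>
      (\<exists>g k. frog_age (fst \<omega>) (snd \<omega>) n g = Some k \<and> walk (snd \<omega>) g (Suc k) = fst f))"
    (is "Measurable.pred M ?c")
  \<comment> \<open>\<open>M\<close> has no coordinate \<open>\<eta> 0\<close>; for
    \<open>fst f = 0\<close> the predicate is constantly false.\<close>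
  proof (cases "fst f = 0")
    case False
    note measurable_config[OF False, measurable]
    show ?thesis by measurable
  qed simp
  have "(\<lambda>\<omega>. case x of Some k \<Rightarrow> Some (Suc k) | None \<Rightarrow> if ?c \<omega> then Some 0 else None)
     \<in> measurable M (count_space UNIV)" for x
    using c by (cases x) simp_all
  from measurable_compose_countable[OF this Suc.IH[of f]] show ?case
    by (simp only: frog_age.simps)
qed simp

lemma recurrence_event:
  "{\<omega> \<in> space M. frog_path (fst \<omega>) (snd \<omega>) \<in> origin_visited_infinitely_often} \<in> M.events"
proof -
  note measurable_frog_age [measurable] measurable_walk [measurable]
  have [measurable]: "Measurable.pred M (\<lambda>\<omega>. frog_path (fst \<omega>) (snd \<omega>) n f = Some 0)" for n f
  proof -
    have "(\<lambda>\<omega>. frog_path (fst \<omega>) (snd \<omega>) n f = Some 0)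
      = (\<lambda>\<omega>. \<exists>k. frog_age (fst \<omega>) (snd \<omega>) n f = Some k \<and> walk (snd \<omega>) f k = 0)"
      by (auto simp: frog_path_def fun_eq_iff)
    then show ?thesis by simp
  qed
  have eq: "(\<lambda>\<omega>. frog_path (fst \<omega>) (snd \<omega>) \<in> origin_visited_infinitely_often)
     = (\<lambda>\<omega>. \<forall>m. \<exists>n. n > m \<and> (\<exists>f. frog_path (fst \<omega>) (snd \<omega>) n f = Some 0))"
    by (auto simp: origin_visited_infinitely_often_def infinite_nat_iff_unbounded fun_eq_iff)
  have "Measurable.pred M (\<lambda>\<omega>. frog_path (fst \<omega>) (snd \<omega>) \<in> origin_visited_infinitely_often)"
    unfolding eq by measurable
  then show ?thesis by (simp add: pred_def)
qed

text \<open>Fubini for null sets: an almost sure event of the product measure has quenched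
  probability 1 for almost every configuration, and \<open>frog_prob\<close> integrates the quenched
  probability.\<close>

lemma frog_prob_eq_1:
  assumes "AE \<omega> in M. frog_path (fst \<omega>) (snd \<omega>) \<in> A"
    and [measurable]: "{\<omega> \<in> space M. frog_path (fst \<omega>) (snd \<omega>) \<in> A} \<in> M.events"
  shows "frog_prob p \<mu> A = 1"
proof -
  interpret C: prob_space "iid_config \<mu> :: (int ^ 'd \<Rightarrow> nat) measure" by (rule prob_space_config)
  interpret I: prob_space "increments p" by (rule prob_space_increments)
  interpret CI: pair_prob_space "iid_config \<mu> :: (int ^ 'd \<Rightarrow> nat) measure" "increments p" ..
  let ?X = "{\<omega> \<in> space M. frog_path (fst \<omega>) (snd \<omega>) \<in> A}"
  have X: "?X \<in> sets (iid_config \<mu> \<Otimes>\<^sub>M increments p)" using assms(2) by (simp only: M_def)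
  have sec: "{\<xi> \<in> space (increments p). frog_path \<eta> \<xi> \<in> A} = Pair \<eta> -` ?X"
    if "\<eta> \<in> space (iid_config \<mu>)" for \<eta>
    using that by (auto simp: M_def space_pair_measure)
  have "(\<lambda>\<eta>. measure (increments p) (Pair \<eta> -` ?X)) \<in> borel_measurable (iid_config \<mu>)"
    unfolding measure_def using I.measurable_emeasure_Pair[OF X] by measurable
  then have meas: "(\<lambda>\<eta>. quenched_prob p \<eta> A) \<in> borel_measurable (iid_config \<mu>)"
    by (rule measurable_cong[THEN iffD1, rotated]) (simp add: quenched_prob_def sec)
  have "AE \<omega> in iid_config \<mu> \<Otimes>\<^sub>M increments p. frog_path (fst \<omega>) (snd \<omega>) \<in> A"
    using assms(1) by (simp only: M_def)
  from CI.AE_pair[OF this]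
  have AE: "AE \<eta> in iid_config \<mu>. AE \<xi> in increments p. frog_path \<eta> \<xi> \<in> A"
    by simp
  have one: "AE \<eta> in iid_config \<mu>. quenched_prob p \<eta> A = 1"
    using AE AE_space
  proof eventually_elim
    case (elim \<eta>)
    have "Pair \<eta> -` ?X \<in> sets (increments p)" using X by (rule sets_Pair1)
    then have "{\<xi> \<in> space (increments p). frog_path \<eta> \<xi> \<in> A} \<in> sets (increments p)"
      using sec elim(2) by simp
    then show ?case
      unfolding quenched_prob_def using I.prob_eq_1 elim(1) by (subst I.prob_eq_1) auto
  qed
  have "frog_prob p \<mu> A = (LINT \<eta>|(iid_config \<mu> :: (int ^ 'd \<Rightarrow> nat) measure). 1)"
    unfolding frog_prob_def by (rule integral_cong_AE) (use meas one in auto)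
  then show ?thesis by (simp add: C.prob_space)
qed

end

section \<open>Moments and parabolas\<close>

lemma suminf_ennreal_finite:
  fixes f :: "nat \<Rightarrow> real"
  assumes "summable f" "\<And>n. 0 \<le> f n"
  shows "(\<Sum>n. ennreal (f n)) < \<infinity>"
  using suminf_ennreal_eq[OF assms(2) summable_sums[OF assms(1)]] by simp

text \<open>The upper half of \<open>{1..N}\<close> has at least \<open>N / 2\<close> elements, and
  there \<open>sqrt n\<close> is at least \<open>sqrt N / 2\<close>.\<close>

lemma sqrt_power_le_sum:
  fixes N d :: nat
  assumes "1 \<le> d"
  shows "sqrt N ^ (Suc d) \<le> 2 ^ d * (\<Sum>n\<in>{1..N}. sqrt n ^ (d - 1))"
proof -
  let ?I = "{N - N div 2..N} - {0}"
  have "sqrt N ^ (Suc d) = N * sqrt N ^ (d - 1)"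
    using assms by (cases d) (simp_all add: mult.assoc[symmetric])
  also have "\<dots> \<le> 2 ^ d * ((N / 2) * (sqrt N / 2) ^ (d - 1))"
    using assms by (cases d) (simp_all add: power_divide)
  also have "(N / 2) * (sqrt N / 2) ^ (d - 1) \<le> (\<Sum>n\<in>?I. (sqrt N / 2) ^ (d - 1))"
  proof -
    have "N \<le> 2 * card ?I"
      by (cases "N = 0") (auto simp: card_Diff_singleton_if)
    then have "N / 2 \<le> card ?I" by linarith
    from mult_right_mono[OF this, of "(sqrt N / 2) ^ (d - 1)"] show ?thesis by simp
  qed
  also have "(\<Sum>n\<in>?I. (sqrt N / 2) ^ (d - 1)) \<le> (\<Sum>n\<in>?I. sqrt n ^ (d - 1))"
  proof (intro sum_mono power_mono)
    fix n assume "n \<in> ?I"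
    then have "N \<le> 4 * n" by auto
    then have "sqrt N \<le> sqrt (4 * n)" by (simp add: real_sqrt_le_iff)
    then show "sqrt N / 2 \<le> sqrt n" by (simp add: real_sqrt_mult)
  qed simp
  also have "\<dots> \<le> (\<Sum>n\<in>{1..N}. sqrt n ^ (d - 1))"
    by (intro sum_mono2) auto
  finally show ?thesis by simp
qed

text \<open>For \<open>k \<ge> 1\<close> the indicator selects the \<open>n\<close> with
  \<open>n \<le> log k / C\<close>. Summing \<open>n^((d-1)/2)\<close> over them gives the order
  \<open>N^((d+1)/2)\<close> with \<open>N = floor (log k / C)\<close>; the additive constant takes
  care of \<open>N = 0\<close>.\<close>

lemma log_plus_powr_le:
  fixes C :: real
  assumes "0 < C" "1 \<le> d"
  shows "ennreal (log_plus (real k) powr ((real d + 1) / 2))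
    \<le> ennreal (sqrt C ^ (Suc d)) + ennreal (sqrt (2 * C) ^ (Suc d) * 2 ^ d) *
       (\<Sum>n::nat. ennreal (sqrt n ^ (d - 1)) * indicator {k. exp (C * real n) \<le> real k} k)"
proof -
  define l where "l = log_plus (real k)"
  have "0 \<le> l" by (simp add: l_def log_plus_def)
  have lp: "l powr ((real d + 1) / 2) = sqrt l ^ (Suc d)"
  proof (cases "l = 0")
    case False
    then have "l powr ((real d + 1) / 2) = (l powr (1/2)) powr (real (Suc d))"
      by (simp add: powr_powr add.commute)
    also have "\<dots> = sqrt l ^ (Suc d)"
      using False \<open>0 \<le> l\<close> by (subst powr_realpow) (auto simp: powr_half_sqrt)
    finally show ?thesis .
  qed simp
  define N where "N = nat \<lfloor>l / C\<rfloor>"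
  have N: "real N \<le> l / C" "l / C \<le> N + 1"
    using \<open>0 \<le> l\<close> \<open>0 < C\<close> unfolding N_def by (auto simp: of_nat_nat) linarith+
  show ?thesis
  proof (cases "N = 0")
    case True
    then have "sqrt l \<le> sqrt C" using N \<open>0 < C\<close> by (simp add: field_simps)
    then have "sqrt l ^ (Suc d) \<le> sqrt C ^ (Suc d)" using \<open>0 \<le> l\<close> by (intro power_mono) auto
    then have "ennreal (sqrt l ^ (Suc d)) \<le> ennreal (sqrt C ^ (Suc d))" by (rule ennreal_leI)
    then show ?thesis unfolding l_def[symmetric] lp by (rule add_increasing2[rotated]) simp
  next
    case False
    have in_set: "exp (C * real n) \<le> real k" if "n \<in> {1..N}" for n
    proof -
      have "real n \<le> l / C" using that N by simp
      then have "C * real n \<le> l" using \<open>0 < C\<close> by (simp add: field_simps)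
      moreover have "0 < C * real n" using that \<open>0 < C\<close> by simp
      ultimately have "k \<noteq> 0" "C * real n \<le> ln (real k)"
        by (auto simp: l_def log_plus_def max_def split: if_splits)
      then show ?thesis by (simp add: ln_ge_iff)
    qed
    have "l \<le> C * (N + 1)" using N \<open>0 < C\<close> by (simp add: field_simps)
    also have "\<dots> \<le> C * (2 * N)" using False \<open>0 < C\<close> by (intro mult_left_mono) auto
    finally have "sqrt l \<le> sqrt (2 * C) * sqrt N" by (simp add: real_sqrt_mult[symmetric] mult_ac)
    then have "sqrt l ^ (Suc d) \<le> (sqrt (2 * C) * sqrt N) ^ (Suc d)"
      using \<open>0 \<le> l\<close> by (intro power_mono) auto
    also have "\<dots> = sqrt (2 * C) ^ (Suc d) * sqrt N ^ (Suc d)" by (rule power_mult_distrib)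
    also have "\<dots> \<le> sqrt (2 * C) ^ (Suc d) * (2 ^ d * (\<Sum>n\<in>{1..N}. sqrt n ^ (d - 1)))"
      using \<open>0 < C\<close> by (intro mult_left_mono sqrt_power_le_sum \<open>1 \<le> d\<close>) auto
    finally have "ennreal (sqrt l ^ (Suc d)) \<le>
        ennreal (sqrt (2 * C) ^ (Suc d) * 2 ^ d * (\<Sum>n\<in>{1..N}. sqrt n ^ (d - 1)))"
      by (intro ennreal_leI) (simp only: mult.assoc)
    also have "\<dots> = ennreal (sqrt (2 * C) ^ (Suc d) * 2 ^ d) * (\<Sum>n\<in>{1..N}. ennreal (sqrt n ^ (d - 1)))"
      using \<open>0 < C\<close> by (subst ennreal_mult) (auto intro!: sum_nonneg simp: sum_ennreal)
    also have "(\<Sum>n\<in>{1..N}. ennreal (sqrt n ^ (d - 1)))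
      = (\<Sum>n\<in>{1..N}. ennreal (sqrt n ^ (d - 1)) * indicator {k. exp (C * real n) \<le> real k} k)"
      using in_set by (intro sum.cong) auto
    also have "\<dots> \<le> (\<Sum>n::nat. ennreal (sqrt n ^ (d - 1)) * indicator {k. exp (C * real n) \<le> real k} k)"
      by (intro sum_le_suminf) auto
    finally show ?thesis
      unfolding l_def[symmetric] lp by (simp add: add_increasing mult_left_mono)
  qed
qed

text \<open>The pointwise bound is integrated term by term: if the series converged, the moment
  would be finite.\<close>

lemma log_moment_infinite_imp_not_summable:
  fixes \<mu> :: "nat pmf" and C :: real
  assumes C: "0 < C" and d: "1 \<le> d"
    and inf: "(\<integral>\<^sup>+k. ennreal (log_plus (real k) powr ((real d + 1) / 2)) \<partial>measure_pmf \<mu>) = \<infinity>"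
  shows "\<not> summable (\<lambda>n::nat. sqrt n ^ (d - 1) * measure (measure_pmf \<mu>) {k. exp (C * real n) \<le> real k})"
proof
  assume sum: "summable (\<lambda>n::nat. sqrt n ^ (d - 1) * measure (measure_pmf \<mu>) {k. exp (C * real n) \<le> real k})"
  let ?A = "ennreal (sqrt C ^ (Suc d))" and ?B = "ennreal (sqrt (2 * C) ^ (Suc d) * 2 ^ d)"
  let ?f = "\<lambda>n k. ennreal (sqrt (real n) ^ (d - 1)) * indicator {k. exp (C * real n) \<le> real k} k"
  have "(\<integral>\<^sup>+k. ennreal (log_plus (real k) powr ((real d + 1) / 2)) \<partial>measure_pmf \<mu>)
      \<le> (\<integral>\<^sup>+k. ?A + ?B * (\<Sum>n. ?f n k) \<partial>measure_pmf \<mu>)"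
    using log_plus_powr_le[OF C d] by (intro nn_integral_mono)
  also have "\<dots> = ?A + ?B * (\<Sum>n. \<integral>\<^sup>+k. ?f n k \<partial>measure_pmf \<mu>)"
    by (simp add: nn_integral_add nn_integral_cmult nn_integral_suminf)
  also have "(\<Sum>n. \<integral>\<^sup>+k. ?f n k \<partial>measure_pmf \<mu>)
      = (\<Sum>n::nat. ennreal (sqrt n ^ (d - 1) * measure (measure_pmf \<mu>) {k. exp (C * real n) \<le> real k}))"
    by (simp add: nn_integral_cmult measure_pmf.emeasure_eq_measure ennreal_mult)
  also have "?A + ?B * \<dots> < \<infinity>"
  proof -
    have "ennreal a + ennreal b * S < \<infinity>" if "S < \<infinity>" for a b and S :: ennreal
      using that by (simp add: ennreal_mult_less_top)
    moreover have "0 \<le> sqrt (real n) ^ (d - 1) * measure (measure_pmf \<mu>) {k. exp (C * real n) \<le> real k}" for n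
      by (intro mult_nonneg_nonneg zero_le_power real_sqrt_ge_zero measure_nonneg of_nat_0_le_iff)
    ultimately show ?thesis using suminf_ennreal_finite[OF sum] by blast
  qed
  finally show False using inf by simp
qed

lemma summable_power_times_exp_minus_sqrt:
  fixes c :: real
  assumes "0 < c"
  shows "summable (\<lambda>n::nat. real (n + 1) ^ d * exp (- (c * sqrt n)))"
proof (rule summable_comparison_test_ev)
  \<comment> \<open>\<open>exp x \<ge> x^(2 * m) / fact (2 * m)\<close> at
    \<open>x = c * sqrt n\<close> gives decay \<open>n^(-m)\<close>; the choice \<open>d + 2\<close>
    leaves \<open>n^(-2)\<close> after the factor \<open>n^d\<close>.\<close>
  define m where "m = d + 2"
  define K where "K = 2 ^ d * fact (2 * m) / c ^ (2 * m)"
  have "real (n + 1) ^ d * exp (- (c * sqrt n)) \<le> K * (1 / real n ^ 2)" if "1 \<le> n" for n :: nat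
  proof -
    have "(c * sqrt n) ^ (2 * m) / fact (2 * m) \<le> exp (c * sqrt n)"
    proof -
      have "(\<Sum>i\<in>{2 * m}. (c * sqrt n) ^ i /\<^sub>R fact i) \<le> exp (c * sqrt n)"
        unfolding exp_def using assms by (intro sum_le_suminf summable_exp_generic) auto
      then show ?thesis by (simp add: divide_inverse mult.commute)
    qed
    moreover have "(c * sqrt n) ^ (2 * m) = c ^ (2 * m) * real n ^ m"
      by (simp add: power_mult_distrib power_mult)
    ultimately have e: "c ^ (2 * m) * real n ^ m / fact (2 * m) \<le> exp (c * sqrt n)" by simp
    have "real (n + 1) ^ d \<le> (2 * real n) ^ d" using that by (intro power_mono) auto
    then have "real (n + 1) ^ d * exp (- (c * sqrt n)) \<le> (2 * real n) ^ d / exp (c * sqrt n)"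
      by (simp add: exp_minus divide_inverse mult_right_mono)
    also have "\<dots> \<le> (2 * real n) ^ d / (c ^ (2 * m) * real n ^ m / fact (2 * m))"
      using e that assms by (intro divide_left_mono) auto
    also have "\<dots> = K * (1 / real n ^ 2)"
    proof -
      have "real n ^ m = real n ^ d * real n ^ 2" by (simp add: m_def power_add power2_eq_square)
      then show ?thesis using that assms unfolding K_def power_mult_distrib by simp
    qed
    finally show ?thesis .
  qed
  then show "\<forall>\<^sub>F n in sequentially. norm (real (n + 1) ^ d * exp (- (c * sqrt n))) \<le> K * (1 / real n ^ 2)"
    by (intro eventually_sequentiallyI[of 1]) simp
  show "summable (\<lambda>n. K * (1 / real n ^ 2))"
    by (intro summable_mult inverse_power_summable[of 2, simplified inverse_eq_divide]) simp
qed

text \<open>Squaring the condition \<open>z_j \<le> sqrt n\<close> keeps it within the integers.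
  Each layer is a box and can be counted as a product.\<close>

definition parabola :: "'d::finite \<Rightarrow> nat \<Rightarrow> (int ^ 'd) set" where
  "parabola j1 n = {z. z $ j1 = int n \<and> (\<forall>j. j \<noteq> j1 \<longrightarrow> 0 \<le> z $ j \<and> (z $ j)\<^sup>2 \<le> int n)}"

lemma parabola_eq_image:
  "parabola j1 n = vec_lambda ` PiE UNIV (\<lambda>j. if j = j1 then {int n} else {k. 0 \<le> k \<and> k\<^sup>2 \<le> int n})"
proof (intro set_eqI iffI)
  fix z assume "z \<in> parabola j1 n"
  then have "vec_nth z \<in> PiE UNIV (\<lambda>j. if j = j1 then {int n} else {k. 0 \<le> k \<and> k\<^sup>2 \<le> int n})"
    by (auto simp: parabola_def PiE_def)
  then show "z \<in> vec_lambda ` PiE UNIV (\<lambda>j. if j = j1 then {int n} else {k. 0 \<le> k \<and> k\<^sup>2 \<le> int n})"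
    by (rule rev_image_eqI) (simp add: vec_nth_inverse)
next
  fix z assume "z \<in> vec_lambda ` PiE UNIV (\<lambda>j. if j = j1 then {int n} else {k. 0 \<le> k \<and> k\<^sup>2 \<le> int n})"
  then obtain g where z: "z = vec_lambda g"
    and g: "\<And>j. g j \<in> (if j = j1 then {int n} else {k. 0 \<le> k \<and> k\<^sup>2 \<le> int n})"
    by (auto simp: PiE_def Pi_def)
  have "0 \<le> g j \<and> (g j)\<^sup>2 \<le> int n" if "j \<noteq> j1" for j using g[of j] that by simp
  then show "z \<in> parabola j1 n"
    unfolding parabola_def z using g[of j1] by simp
qed

lemma nonneg_squares_subset: "{k :: int. 0 \<le> k \<and> k\<^sup>2 \<le> int n} \<subseteq> {0..int n}"
proof
  fix k :: int assume "k \<in> {k. 0 \<le> k \<and> k\<^sup>2 \<le> int n}"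
  moreover have "k \<le> k\<^sup>2" using zero_le_power2[of "k - 1"] self_le_power[of k 2]
    by (cases "k \<le> 0") (auto intro: order_trans)
  ultimately show "k \<in> {0..int n}" by auto
qed

text \<open>The lower bound has the true order and counts the available vertices; the upper bound is
  crude, being used against \<open>exp (- (c * sqrt n))\<close> only.\<close>

lemma finite_parabola: "finite (parabola j1 n)"
  and card_parabola_ge: "sqrt n ^ (CARD('d) - 1) \<le> card (parabola (j1 :: 'd::finite) n)"
  and card_parabola_le: "card (parabola (j1 :: 'd::finite) n) \<le> (n + 1) ^ CARD('d)"
proof -
  let ?S = "{k :: int. 0 \<le> k \<and> k\<^sup>2 \<le> int n}"
  let ?B = "\<lambda>j :: 'd. if j = j1 then {int n} else ?S"
  have finS: "finite ?S" by (rule finite_subset[OF nonneg_squares_subset]) simp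
  have finP: "finite (PiE UNIV ?B)" by (rule finite_PiE) (auto simp: finS)
  then show "finite (parabola j1 n)" by (simp add: parabola_eq_image)
  have "card (parabola j1 n) = card (PiE UNIV ?B)"
    unfolding parabola_eq_image by (rule card_image) (auto simp: inj_on_def vec_lambda_inject)
  also have "\<dots> = (\<Prod>j\<in>UNIV. card (?B j))" by (simp add: card_PiE)
  also have "\<dots> = (\<Prod>j\<in>UNIV - {j1}. card (?B j))"
    by (subst prod.remove[of _ j1]) auto
  also have "\<dots> = (\<Prod>j\<in>UNIV - {j1}. card ?S)" by (rule prod.cong) auto
  also have "\<dots> = card ?S ^ (CARD('d) - 1)" by (simp add: card_Diff_singleton)
  finally have card: "card (parabola j1 n) = card ?S ^ (CARD('d) - 1)" .
  have "sqrt n \<le> card ?S"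
  proof -
    have sub: "{0..\<lfloor>sqrt n\<rfloor>} \<subseteq> ?S"
    proof
      fix k assume k: "k \<in> {0..\<lfloor>sqrt n\<rfloor>}"
      then have "0 \<le> real_of_int k" "real_of_int k \<le> sqrt n" by (auto simp: le_floor_iff)
      then have "(real_of_int k)\<^sup>2 \<le> (sqrt n)\<^sup>2" by (intro power_mono)
      then have "real_of_int (k\<^sup>2) \<le> real_of_int (int n)" by simp
      then show "k \<in> ?S" using k by (simp only: of_int_le_iff) simp
    qed
    have "sqrt n \<le> real (card {0..\<lfloor>sqrt n\<rfloor>})" using real_sqrt_ge_zero[of n] by simp
    also have "\<dots> \<le> real (card ?S)" using card_mono[OF finS sub] by simp
    finally show ?thesis .
  qed
  then show "sqrt n ^ (CARD('d) - 1) \<le> card (parabola j1 n)"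
    unfolding card of_nat_power by (intro power_mono) auto
  have "card ?S \<le> n + 1" using card_mono[OF _ nonneg_squares_subset[of n]] by simp
  then have "card (parabola j1 n) \<le> (n + 1) ^ (CARD('d) - 1)" unfolding card by (intro power_mono) auto
  also have "\<dots> \<le> (n + 1) ^ CARD('d)" by (intro power_increasing) auto
  finally show "card (parabola j1 n) \<le> (n + 1) ^ CARD('d)" .
qed

lemma parabola_layer: "z \<in> parabola j1 n \<Longrightarrow> z $ j1 = int n"
  by (simp add: parabola_def)

text \<open>Both coordinates lie in \<open>[0, sqrt n]\<close>, since layer \<open>s\<close> is no
  wider than layer \<open>n\<close>.\<close>

lemma parabola_diff_le:
  assumes "w \<in> parabola j1 s" "z \<in> parabola j1 n" "s \<le> n" "j \<noteq> j1"
  shows "\<bar>real_of_int ((z - w) $ j)\<bar> \<le> sqrt n"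
proof -
  have "0 \<le> w $ j" "(w $ j)\<^sup>2 \<le> int n" "0 \<le> z $ j" "(z $ j)\<^sup>2 \<le> int n"
    using assms by (auto simp: parabola_def)
  moreover have "real_of_int k \<le> sqrt n" if "k\<^sup>2 \<le> int n" for k :: int
  proof (rule real_le_rsqrt)
    have "real_of_int (k\<^sup>2) \<le> real_of_int (int n)" using that by (simp only: of_int_le_iff)
    then show "(real_of_int k)\<^sup>2 \<le> real n" by simp
  qed
  ultimately have "0 \<le> real_of_int (w $ j)" "real_of_int (w $ j) \<le> sqrt n"
    "0 \<le> real_of_int (z $ j)" "real_of_int (z $ j) \<le> sqrt n" by auto
  then show ?thesis by simp
qed

lemma parabola_norm_le:
  assumes "z \<in> parabola (j1 :: 'd::finite) n"
  shows "(\<Sum>j\<in>UNIV. \<bar>z $ j\<bar>) \<le> int (CARD('d) * n)"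
proof -
  have "\<bar>z $ j\<bar> \<le> int n" for j
    using assms nonneg_squares_subset[of n] by (cases "j = j1") (auto simp: parabola_def)
  then have "(\<Sum>j\<in>UNIV. \<bar>z $ j\<bar>) \<le> (\<Sum>j\<in>(UNIV :: 'd set). int n)" by (intro sum_mono)
  then show ?thesis by simp
qed

section \<open>Visiting the parabola and returning to the origin\<close>

lemma card_even_shift_ge: "L div 2 \<le> card {i. i < L \<and> even (k + int i)}"
proof -
  let ?f = "\<lambda>i. 2 * i + (if even k then 0 else 1)"
  have "?f ` {..<L div 2} \<subseteq> {i. i < L \<and> even (k + int i)}" by auto
  from card_mono[OF _ this] have "card (?f ` {..<L div 2}) \<le> card {i. i < L \<and> even (k + int i)}" by simp
  moreover have "card (?f ` {..<L div 2}) = L div 2" by (subst card_image) (auto simp: inj_on_def)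
  ultimately show ?thesis by simp
qed

locale drift_frog_model = frog_model p \<mu>
  for p :: "(int ^ 'd::finite) pmf" and \<mu> :: "nat pmf" +
  fixes j1 :: 'd and a :: real
  assumes a_pos: "0 < a" and a_le_1: "a \<le> 1"
    and drift: "\<And>j. q (j, True) - q (j, False) = (if j = j1 then a else 0)"
    and log_moment: "(\<integral>\<^sup>+k. ennreal (log_plus (real k) powr ((real CARD('d) + 1) / 2)) \<partial>measure_pmf \<mu>) = \<infinity>"
begin

lemma not_summable_tail:
  assumes "0 < C"
  shows "\<not> summable (\<lambda>n::nat. sqrt n ^ (CARD('d) - 1) * measure (measure_pmf \<mu>) {k. exp (C * real n) \<le> real k})"
  by (rule log_moment_infinite_imp_not_summable[OF assms _ log_moment]) (simp add: Suc_le_eq)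

text \<open>If \<open>{m..}\<close> had measure 0, all terms with \<open>n \<ge> m\<close> of the
  divergent series for \<open>C = 1\<close> would vanish.\<close>

lemma tail_pos: "0 < measure (measure_pmf \<mu>) {m..}"
proof (rule ccontr)
  assume "\<not> ?thesis"
  then have 0: "measure (measure_pmf \<mu>) {m..} = 0" by (simp add: zero_less_measure_iff)
  have "measure (measure_pmf \<mu>) {k. exp (1 * real n) \<le> real k} = 0" if "m \<le> n" for n
  proof -
    have "{k. exp (1 * real n) \<le> real k} \<subseteq> {m..}"
    proof
      fix k assume "k \<in> {k. exp (1 * real n) \<le> real k}"
      then have "1 + real n \<le> real k" using exp_ge_add_one_self[of "real n"]
        by (simp only: mult_1_left mem_Collect_eq)
      then show "k \<in> {m..}" using that by simp
    qed
    then have "measure (measure_pmf \<mu>) {k. exp (1 * real n) \<le> real k} \<le> measure (measure_pmf \<mu>) {m..}"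
      by (intro measure_pmf.finite_measure_mono) auto
    then show ?thesis using 0 measure_nonneg[of "measure_pmf \<mu>"] by (simp add: order_antisym)
  qed
  then have "summable (\<lambda>n::nat. sqrt n ^ (CARD('d) - 1) * measure (measure_pmf \<mu>) {k. exp (1 * real n) \<le> real k})"
    by (intro summable_finite[of "{..<m}"]) auto
  then show False using not_summable_tail[of 1] by simp
qed

section \<open>Events attached to a single vertex\<close>

definition rows_at :: "int ^ 'd \<Rightarrow> 'd coord set" where
  "rows_at x = {Inr ((x, i), k) |i k. True}"

text \<open>All the randomness attached to \<open>x\<close>; the rows include every potential frog
  \<open>(x, i)\<close>, whether or not \<open>i < \<eta> x\<close>.\<close>

definition site :: "int ^ 'd \<Rightarrow> 'd coord set" where
  "site x = insert (Inl x) (rows_at x)"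

lemma site_disjoint: "x \<noteq> y \<Longrightarrow> site x \<inter> site y = {}"
  by (auto simp: site_def rows_at_def)

lemma site_coords: "x \<noteq> 0 \<Longrightarrow> site x \<subseteq> coords"
  by (auto simp: site_def rows_at_def coords_def)

lemma rows_at_coords: "rows_at x \<subseteq> coords"
  by (auto simp: rows_at_def coords_def)

lemma F_setI: "Measurable.pred (F J) P \<Longrightarrow> {\<omega> \<in> space M. P \<omega>} \<in> sets (F J)"
  by (simp add: pred_def)

lemma pred_F_tail:
  assumes "Inl x \<in> J" shows "Measurable.pred (F J) (\<lambda>\<omega>. m \<le> fst \<omega> x)"
  by (rule measurable_compose[OF measurable_F_config[OF assms], of "\<lambda>k. m \<le> k"]) simp

lemma pred_F_row:
  assumes "rows_at x \<subseteq> J" shows "Measurable.pred (F J) (\<lambda>\<omega>. hits (path_of (x, i) \<omega>) z)"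
  by (rule pred_F_row_hits) (use assms in \<open>auto simp: rows_at_def\<close>)

text \<open>Paths belong to potential frogs, so they are independent of how many of these
  exist.\<close>

lemma prob_tail_Int:
  assumes x: "x \<noteq> 0" and P: "Measurable.pred (F (rows_at x)) P"
  shows "M.prob {\<omega> \<in> space M. m \<le> fst \<omega> x \<and> P \<omega>}
    = measure (measure_pmf \<mu>) {m..} * M.prob {\<omega> \<in> space M. P \<omega>}"
proof -
  have "M.prob ({\<omega> \<in> space M. m \<le> fst \<omega> x} \<inter> {\<omega> \<in> space M. P \<omega>})
    = M.prob {\<omega> \<in> space M. m \<le> fst \<omega> x} * M.prob {\<omega> \<in> space M. P \<omega>}"
  proof (rule prob_Int_F)
    show "{\<omega> \<in> space M. m \<le> fst \<omega> x} \<in> sets (F {Inl x})"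
      by (intro F_setI pred_F_tail) simp
    show "{\<omega> \<in> space M. P \<omega>} \<in> sets (F (rows_at x))" by (rule F_setI[OF P])
    show "rows_at x \<subseteq> coords" by (rule rows_at_coords)
  qed (use x in \<open>auto simp: coords_def rows_at_def\<close>)
  moreover have "M.prob {\<omega> \<in> space M. m \<le> fst \<omega> x} = measure (measure_pmf \<mu>) {m..}"
    using prob_config[OF x, of "{m..}"] by simp
  moreover have "{\<omega> \<in> space M. m \<le> fst \<omega> x} \<inter> {\<omega> \<in> space M. P \<omega>}
    = {\<omega> \<in> space M. m \<le> fst \<omega> x \<and> P \<omega>}" by auto
  ultimately show ?thesis by simp
qed

lemma disjoint_rows: "disjoint_family_on (\<lambda>i. range (\<lambda>k. Inr ((x, i), k)) :: 'd coord set) K"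
  by (auto simp: disjoint_family_on_def)

lemma row_hits_sets: "{\<omega> \<in> space M. hits (path_of f \<omega>) z} \<in> sets (F (range (\<lambda>k. Inr (f, k))))"
  by (intro F_setI pred_F_row_hits) simp

lemma prob_all_rows_hit:
  "M.prob {\<omega> \<in> space M. \<forall>i<m. hits (path_of (x, i) \<omega>) (h i)} = (\<Prod>i<m. H (h i))"
proof -
  have "M.prob {\<omega> \<in> space M. \<forall>i\<in>{..<m}. \<omega> \<in> {\<omega> \<in> space M. hits (path_of (x, i) \<omega>) (h i)}}
    = (\<Prod>i<m. M.prob {\<omega> \<in> space M. hits (path_of (x, i) \<omega>) (h i)})"
    by (rule prob_INT_F[OF _ _ disjoint_rows row_hits_sets]) (auto simp: coords_def)
  moreover have "{\<omega> \<in> space M. \<forall>i\<in>{..<m}. \<omega> \<in> {\<omega> \<in> space M. hits (path_of (x, i) \<omega>) (h i)}}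
    = {\<omega> \<in> space M. \<forall>i<m. hits (path_of (x, i) \<omega>) (h i)}" by auto
  ultimately show ?thesis by (simp add: prob_row_hits)
qed

lemma prob_some_row_hits:
  "1 - exp (- (real m * H z)) \<le> M.prob {\<omega> \<in> space M. \<exists>i<m. hits (path_of (x, i) \<omega>) z}"
proof -
  let ?A = "{\<omega> \<in> space M. \<exists>i<m. hits (path_of (x, i) \<omega>) z}"
  have "?A \<in> M.events"
    by (rule subsetD[OF sets_F_events[OF rows_at_coords[of x]]], rule F_setI)
      (intro pred_intros_countable pred_intros_conj1' pred_F_row order_refl)
  then have "M.prob (space M - ?A) = 1 - M.prob ?A" by (rule M.prob_compl)
  moreover have "space M - ?A
     = {\<omega> \<in> space M. \<forall>i\<in>{..<m}. \<omega> \<notin> {\<omega> \<in> space M. hits (path_of (x, i) \<omega>) z}}" by auto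
  moreover have "M.prob \<dots> \<le> exp (- (\<Sum>i\<in>{..<m}. M.prob {\<omega> \<in> space M. hits (path_of (x, i) \<omega>) z}))"
    by (rule prob_avoid_F[OF _ _ disjoint_rows row_hits_sets]) (auto simp: coords_def)
  ultimately show ?thesis by (simp add: prob_row_hits)
qed

text \<open>The frogs that reach \<open>z\<close> are taken from odd layers only; the vertices that
  start the process lie in even layers, which makes the two events independent.\<close>

definition source :: "int ^ 'd \<Rightarrow> nat \<Rightarrow> int ^ 'd \<Rightarrow> (int ^ 'd \<Rightarrow> nat) \<times> ('d frog \<times> nat \<Rightarrow> int ^ 'd) \<Rightarrow> bool" where
  "source v n z \<omega> \<longleftrightarrow> (\<exists>s w. (odd s \<and> n \<le> 4 * s \<and> 2 * s \<le> n \<and> w \<in> parabola j1 s) \<and>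
     1 \<le> fst \<omega> (v + w) \<and> hits (path_of (v + w, 0) \<omega>) (z - w))"

definition odd_coords :: "'d coord set" where
  "odd_coords = (\<Union>x\<in>{x. odd (x $ j1)}. site x)"

lemma odd_coords_sub: "odd_coords \<subseteq> coords"
  unfolding odd_coords_def by (intro UN_least site_coords) auto

lemma pred_source:
  assumes "even (v $ j1)"
  shows "Measurable.pred (F odd_coords) (source v n z)"
proof -
  have "Measurable.pred (F odd_coords) (\<lambda>\<omega>. (odd s \<and> n \<le> 4 * s \<and> 2 * s \<le> n \<and> w \<in> parabola j1 s) \<and>
     1 \<le> fst \<omega> (v + w) \<and> hits (path_of (v + w, 0) \<omega>) (z - w))" for s w
  proof (rule pred_intros_conj1')
    assume "odd s \<and> n \<le> 4 * s \<and> 2 * s \<le> n \<and> w \<in> parabola j1 s"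
    then have "odd ((v + w) $ j1)" using assms parabola_layer[of w j1 s] by simp
    then have "site (v + w) \<subseteq> odd_coords" unfolding odd_coords_def by (intro UN_upper CollectI)
    then have "Inl (v + w) \<in> odd_coords" "rows_at (v + w) \<subseteq> odd_coords" by (auto simp: site_def)
    then show "Measurable.pred (F odd_coords)
        (\<lambda>\<omega>. 1 \<le> fst \<omega> (v + w) \<and> hits (path_of (v + w, 0) \<omega>) (z - w))"
      by (intro pred_intros_logic pred_F_tail pred_F_row)
  qed
  then show ?thesis unfolding source_def[abs_def] by (intro pred_intros_countable)
qed

lemma odd_quarter_to_half:
  fixes n :: nat
  assumes "16 \<le> n"
  shows "real n / 32 \<le> card {s. odd s \<and> n \<le> 4 * s \<and> 2 * s \<le> n}"
proof -
  let ?S = "{s. odd s \<and> n \<le> 4 * s \<and> 2 * s \<le> n}"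
  \<comment> \<open>These indices give \<open>n div 16\<close> consecutive odd numbers
    \<open>2 * i + 1\<close>, all between \<open>n / 4\<close> and \<open>n / 2\<close>.\<close>
  let ?I = "{(n + 7) div 8 ..< (n + 7) div 8 + n div 16}"
  have sub: "(\<lambda>i. 2 * i + 1) ` ?I \<subseteq> ?S" using assms by auto
  have fin: "finite ?S" by (rule finite_subset[of _ "{..n}"]) auto
  have "card ((\<lambda>i. 2 * i + 1) ` ?I) = n div 16" by (subst card_image) (auto simp: inj_on_def)
  with card_mono[OF fin sub] have "n div 16 \<le> card ?S" by simp
  moreover have "n \<le> 32 * (n div 16)" using assms by presburger
  ultimately have "n \<le> 32 * card ?S" by linarith
  then show ?thesis by simp
qed

text \<open>The constants do not depend on \<open>v\<close>; this uniformity is what later allows a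
  random starting vertex.\<close>

lemma prob_not_source:
  "\<exists>c>0. \<exists>n0. \<forall>n\<ge>n0. \<forall>z\<in>parabola j1 n. \<forall>v. even (v $ j1) \<longrightarrow>
     M.prob {\<omega> \<in> space M. \<not> source v n z \<omega>} \<le> exp (- (c * sqrt n))"
proof -
  obtain c0 r0 where "0 < c0" and c0: "\<And>z r. r0 \<le> r \<Longrightarrow> z $ j1 = int r \<Longrightarrow>
    (\<forall>j. j \<noteq> j1 \<longrightarrow> \<bar>real_of_int (z $ j)\<bar> \<le> 2 * sqrt r) \<Longrightarrow> c0 / sqrt r ^ CARD('d) \<le> H z"
    using H_ge_sqrt_power[OF a_pos a_le_1 drift] by blast
  define q1 where "q1 = measure (measure_pmf \<mu>) {1..}"
  have "0 < q1" unfolding q1_def by (rule tail_pos)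
  \<comment> \<open>The number of available vertices, \<open>n / 32 * (sqrt n / 2)^(d-1)\<close>,
    times the chance \<open>q1 * c0 / sqrt n^d\<close> that one of them has a frog which reaches
    \<open>z\<close>, is \<open>c * sqrt n\<close>.\<close>
  define c where "c = q1 * c0 / (32 * 2 ^ (CARD('d) - 1))"
  have "0 < c" using \<open>0 < q1\<close> \<open>0 < c0\<close> by (simp add: c_def)
  have main: "M.prob {\<omega> \<in> space M. \<not> source v n z \<omega>} \<le> exp (- (c * sqrt n))"
    if n: "16 \<le> n" "2 * r0 \<le> n" and z: "z \<in> parabola j1 n" and v: "even (v $ j1)" for n z v
  proof -
    define S where "S = {s. odd s \<and> n \<le> 4 * s \<and> 2 * s \<le> n}"
    have finS: "finite S" unfolding S_def by (rule finite_subset[of _ "{..n}"]) auto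
    define K where "K = (\<Union>s\<in>S. parabola j1 s)"
    have finK: "finite K" unfolding K_def using finS finite_parabola by blast
    define A where "A w = {\<omega> \<in> space M. 1 \<le> fst \<omega> (v + w) \<and> hits (path_of (v + w, 0) \<omega>) (z - w)}" for w
    have nz: "v + w \<noteq> 0" if "w \<in> K" for w
    proof -
      obtain s where "w $ j1 = int s" "odd s"
        using \<open>w \<in> K\<close> parabola_layer unfolding K_def S_def by blast
      then have "odd ((v + w) $ j1)" using v by simp
      then show ?thesis by (metis even_zero zero_index)
    qed
    have A_sets: "A w \<in> sets (F (site (v + w)))" for w
      unfolding A_def by (intro F_setI pred_intros_logic pred_F_tail pred_F_row) (auto simp: site_def)
    have A_prob: "q1 * (c0 / sqrt n ^ CARD('d)) \<le> M.prob (A w)" if "w \<in> K" for w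
    proof -
      obtain s where s: "s \<in> S" "w \<in> parabola j1 s" using \<open>w \<in> K\<close> unfolding K_def by blast
      then have "2 * s \<le> n" "s \<le> n" by (auto simp: S_def)
      have "c0 / sqrt (n - s) ^ CARD('d) \<le> H (z - w)"
      proof (rule c0)
        show "r0 \<le> n - s" using n(2) \<open>2 * s \<le> n\<close> by linarith
        show "(z - w) $ j1 = int (n - s)"
          using parabola_layer[OF z] parabola_layer[OF s(2)] \<open>s \<le> n\<close> by (simp add: of_nat_diff)
        show "\<forall>j. j \<noteq> j1 \<longrightarrow> \<bar>real_of_int ((z - w) $ j)\<bar> \<le> 2 * sqrt (n - s)"
        proof safe
          fix j assume "j \<noteq> j1"
          then have "\<bar>real_of_int ((z - w) $ j)\<bar> \<le> sqrt n"
            by (rule parabola_diff_le[OF s(2) z \<open>s \<le> n\<close>])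
          \<comment> \<open>\<open>2 * s \<le> n\<close> gives \<open>n \<le> 4 * (n - s)\<close>;
            this is why the hitting estimate admits deviations up to
            \<open>2 * sqrt r\<close>.\<close>
          also have "sqrt n \<le> sqrt (4 * (n - s))"
            using \<open>2 * s \<le> n\<close> by (intro real_sqrt_le_mono) linarith
          also have "\<dots> = 2 * sqrt (n - s)" by (simp add: real_sqrt_mult)
          finally show "\<bar>real_of_int ((z - w) $ j)\<bar> \<le> 2 * sqrt (n - s)" .
        qed
      qed
      moreover have "c0 / sqrt n ^ CARD('d) \<le> c0 / sqrt (n - s) ^ CARD('d)"
        using \<open>0 < c0\<close> n \<open>2 * s \<le> n\<close>
        by (intro divide_left_mono power_mono mult_pos_pos zero_less_power) auto
      ultimately have "c0 / sqrt n ^ CARD('d) \<le> H (z - w)" by linarith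
      then have "q1 * (c0 / sqrt n ^ CARD('d)) \<le> q1 * H (z - w)"
        using \<open>0 < q1\<close> by (intro mult_left_mono) auto
      also have "\<dots> = M.prob (A w)"
        unfolding A_def q1_def
        by (subst prob_tail_Int[OF nz[OF that] pred_F_row]) (auto simp: prob_row_hits)
      finally show ?thesis .
    qed
    have cardK: "real n / 32 * (sqrt n / 2) ^ (CARD('d) - 1) \<le> card K"
    proof -
      have "real n / 32 * (sqrt n / 2) ^ (CARD('d) - 1) \<le> card S * (sqrt n / 2) ^ (CARD('d) - 1)"
        using odd_quarter_to_half[OF n(1)] unfolding S_def[symmetric] by (intro mult_right_mono) auto
      also have "\<dots> = (\<Sum>s\<in>S. (sqrt n / 2) ^ (CARD('d) - 1))" by simp
      also have "\<dots> \<le> (\<Sum>s\<in>S. real (card (parabola j1 s)))"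
      proof (rule sum_mono)
        fix s assume "s \<in> S"
        then have "n \<le> 4 * s" by (simp add: S_def)
        then have "sqrt n \<le> sqrt (4 * s)" by (intro real_sqrt_le_mono) linarith
        then have "(sqrt n / 2) ^ (CARD('d) - 1) \<le> sqrt s ^ (CARD('d) - 1)"
          by (intro power_mono) (simp_all add: real_sqrt_mult)
        also have "\<dots> \<le> card (parabola j1 s)" by (rule card_parabola_ge)
        finally show "(sqrt n / 2) ^ (CARD('d) - 1) \<le> card (parabola j1 s)" .
      qed
      also have "\<dots> = card K"
      proof -
        have "card K = (\<Sum>s\<in>S. card (parabola j1 s))"
          unfolding K_def
        proof (rule card_UN_disjoint[OF finS])
          show "\<forall>i\<in>S. \<forall>j\<in>S. i \<noteq> j \<longrightarrow> parabola j1 i \<inter> parabola j1 j = {}"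
            by (auto simp: parabola_def)
        qed (simp add: finite_parabola)
        then show ?thesis by simp
      qed
      finally show ?thesis .
    qed
    have "c * sqrt n = (real n / 32 * (sqrt n / 2) ^ (CARD('d) - 1)) * (q1 * (c0 / sqrt n ^ CARD('d)))"
    proof -
      obtain d where d: "CARD('d) = Suc d" using not0_implies_Suc[of "CARD('d)"] by auto
      define u where "u = sqrt n"
      have "real n = u * u" "0 < u" using n by (auto simp: u_def)
      then show ?thesis unfolding c_def d u_def[symmetric] by (simp add: power_divide)
    qed
    also have "\<dots> \<le> card K * (q1 * (c0 / sqrt n ^ CARD('d)))"
      using \<open>0 < q1\<close> \<open>0 < c0\<close> by (intro mult_right_mono cardK) auto
    also have "\<dots> = (\<Sum>w\<in>K. q1 * (c0 / sqrt n ^ CARD('d)))" by simp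
    also have "\<dots> \<le> (\<Sum>w\<in>K. M.prob (A w))" by (intro sum_mono A_prob)
    finally have sum: "c * sqrt n \<le> (\<Sum>w\<in>K. M.prob (A w))" .
    have "{\<omega> \<in> space M. \<not> source v n z \<omega>} = {\<omega> \<in> space M. \<forall>w\<in>K. \<omega> \<notin> A w}"
      unfolding source_def A_def K_def S_def by blast
    also have "M.prob \<dots> \<le> exp (- (\<Sum>w\<in>K. M.prob (A w)))"
    proof (rule prob_avoid_F[OF finK _ _ A_sets])
      show "site (v + w) \<subseteq> coords" if "w \<in> K" for w by (rule site_coords[OF nz[OF that]])
      show "disjoint_family_on (\<lambda>w. site (v + w)) K"
        unfolding disjoint_family_on_def using site_disjoint by simp
    qed
    also have "\<dots> \<le> exp (- (c * sqrt n))" using sum by simp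
    finally show ?thesis .
  qed
  show ?thesis
  proof (intro exI conjI allI ballI impI)
    show "0 < c" by fact
    fix n z and v :: "int ^ 'd" assume "max 16 (2 * r0) \<le> n" "z \<in> parabola j1 n" "even (v $ j1)"
    then show "M.prob {\<omega> \<in> space M. \<not> source v n z \<omega>} \<le> exp (- (c * sqrt n))"
      by (intro main) auto
  qed
qed

section \<open>Spreading from a given layer on\<close>

definition spread :: "int ^ 'd \<Rightarrow> nat \<Rightarrow> ((int ^ 'd \<Rightarrow> nat) \<times> ('d frog \<times> nat \<Rightarrow> int ^ 'd)) set" where
  "spread v N = {\<omega> \<in> space M. \<forall>n z. N \<le> n \<longrightarrow> z \<in> parabola j1 n \<longrightarrow> source v n z \<omega>}"

lemma spread_sets: "even (v $ j1) \<Longrightarrow> spread v N \<in> sets (F odd_coords)"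
  unfolding spread_def by (intro F_setI pred_intros_countable pred_intros_imp' pred_source)

text \<open>A union bound over all points of all layers from \<open>N\<close> on. The summable bound
  \<open>u\<close> does not involve \<open>v\<close>, hence one \<open>N\<close> serves all
  \<open>v\<close>.\<close>

lemma prob_spread:
  assumes "0 < \<epsilon>"
  shows "\<exists>N\<ge>1. \<forall>v. even (v $ j1) \<longrightarrow> 1 - \<epsilon> \<le> M.prob (spread v N)"
proof -
  obtain c n0 where "0 < c" and c: "\<And>n z v. n0 \<le> n \<Longrightarrow> z \<in> parabola j1 n \<Longrightarrow> even (v $ j1) \<Longrightarrow>
     M.prob {\<omega> \<in> space M. \<not> source v n z \<omega>} \<le> exp (- (c * sqrt n))"
    using prob_not_source by blast
  define u where "u n = real (n + 1) ^ CARD('d) * exp (- (c * sqrt n))" for n :: nat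
  have u: "summable u" unfolding u_def by (rule summable_power_times_exp_minus_sqrt[OF \<open>0 < c\<close>])
  have u0: "0 \<le> u n" for n by (simp add: u_def)
  obtain N0 where N0: "\<And>N. N0 \<le> N \<Longrightarrow> norm (\<Sum>i. u (i + N)) < \<epsilon>"
    using suminf_exist_split[OF assms u] by blast
  define N where "N = max 1 (max n0 N0)"
  have "1 - \<epsilon> \<le> M.prob (spread v N)" if v: "even (v $ j1)" for v
  proof -
    define B where "B n = (\<Union>z\<in>parabola j1 n. {\<omega> \<in> space M. \<not> source v n z \<omega>})" for n
    have src_ev: "{\<omega> \<in> space M. \<not> source v n z \<omega>} \<in> M.events" for n z
      using sets_F_events[OF odd_coords_sub] pred_source[OF v]
      by (auto intro!: F_setI pred_intros_logic)
    have B_ev: "B n \<in> M.events" for n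
      unfolding B_def using src_ev finite_parabola by (intro sets.finite_UN) auto
    have B_le: "M.prob (B n) \<le> u n" if "n0 \<le> n" for n
    proof -
      have "M.prob (B n) \<le> (\<Sum>z\<in>parabola j1 n. M.prob {\<omega> \<in> space M. \<not> source v n z \<omega>})"
        unfolding B_def using src_ev finite_parabola by (intro M.finite_measure_subadditive_finite) auto
      also have "\<dots> \<le> (\<Sum>z\<in>parabola j1 n. exp (- (c * sqrt n)))"
        using c[OF that _ v] by (intro sum_mono)
      also have "\<dots> = card (parabola j1 n) * exp (- (c * sqrt n))" by simp
      also have "\<dots> \<le> u n"
      proof -
        have "real (card (parabola j1 n)) \<le> real ((n + 1) ^ CARD('d))"
          using card_parabola_le[of j1 n] by (simp only: of_nat_le_iff)
        then show ?thesis unfolding u_def by (intro mult_right_mono) (auto simp: add.commute)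
      qed
      finally show ?thesis .
    qed
    have sp_ev: "spread v N \<in> M.events" using spread_sets[OF v] sets_F_events[OF odd_coords_sub] by blast
    have "space M - spread v N \<subseteq> (\<Union>i. B (i + N))"
    proof
      fix \<omega> assume "\<omega> \<in> space M - spread v N"
      then obtain n z where n: "N \<le> n" "z \<in> parabola j1 n" "\<not> source v n z \<omega>" "\<omega> \<in> space M"
        unfolding spread_def by blast
      then have "\<omega> \<in> B (n - N + N)" by (auto simp: B_def)
      then show "\<omega> \<in> (\<Union>i. B (i + N))" by blast
    qed
    then have "M.prob (space M - spread v N) \<le> M.prob (\<Union>i. B (i + N))"
      using B_ev by (intro M.finite_measure_mono) auto
    also have "\<dots> \<le> (\<Sum>i. M.prob (B (i + N)))"
    proof (rule M.finite_measure_subadditive_countably)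
      show "range (\<lambda>i. B (i + N)) \<subseteq> M.events" using B_ev by auto
      show "summable (\<lambda>i. M.prob (B (i + N)))"
        using B_le by (intro summable_comparison_test'[OF summable_ignore_initial_segment[OF u, of N], of 0])
          (auto simp: N_def)
    qed
    also have "\<dots> \<le> (\<Sum>i. u (i + N))"
    proof (rule suminf_le)
      show "summable (\<lambda>i. M.prob (B (i + N)))"
        using B_le by (intro summable_comparison_test'[OF summable_ignore_initial_segment[OF u, of N], of 0])
          (auto simp: N_def)
    qed (use B_le summable_ignore_initial_segment[OF u, of N] in \<open>auto simp: N_def\<close>)
    also have "\<dots> < \<epsilon>"
    proof -
      have "N0 \<le> N" by (simp add: N_def)
      from N0[OF this] show ?thesis by simp
    qed
    finally show ?thesis using M.prob_compl[OF sp_ev] by simp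
  qed
  moreover have "1 \<le> N" by (simp add: N_def)
  ultimately show ?thesis by blast
qed

section \<open>Choice of the starting vertex\<close>

definition even_coords :: "'d coord set" where
  "even_coords = (\<Union>x\<in>{x. even (x $ j1) \<and> x \<noteq> 0}. site x)"

text \<open>Only the path of the initial frog. Site 0 is absent from \<open>even_coords\<close>, so
  this path is independent of the frogs counted there.\<close>

definition origin_row :: "'d coord set" where
  "origin_row = range (\<lambda>k. Inr ((0, 0), k))"

lemma even_coords_sub: "even_coords \<subseteq> coords"
  unfolding even_coords_def by (intro UN_least site_coords) auto

lemma origin_row_sub: "origin_row \<subseteq> coords"
  by (auto simp: origin_row_def coords_def)

lemma origin_even_disjoint: "origin_row \<inter> even_coords = {}"
  by (auto simp: origin_row_def even_coords_def site_def rows_at_def)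

lemma even_odd_disjoint: "(origin_row \<union> even_coords) \<inter> odd_coords = {}"
  by (auto simp: origin_row_def even_coords_def odd_coords_def site_def rows_at_def)

text \<open>Layer 0 is left out: it consists of 0 only, which corresponds to the starting vertex
  itself.\<close>

definition targets :: "nat \<Rightarrow> (int ^ 'd) set" where
  "targets N = (\<Union>n\<in>{1..<N}. parabola j1 n)"

lemma finite_targets: "finite (targets N)"
  unfolding targets_def by (intro finite_UN_I finite_atLeastLessThan finite_parabola)

text \<open>Each target has a frog of its own, the \<open>i\<close>-th frog for the
  \<open>i\<close>-th target of an enumeration; so the probability is a tail of \<open>\<mu>\<close>
  times a product of hitting probabilities.\<close>

definition start :: "int ^ 'd \<Rightarrow> nat \<Rightarrow> ((int ^ 'd \<Rightarrow> nat) \<times> ('d frog \<times> nat \<Rightarrow> int ^ 'd)) set" where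
  "start v N = {\<omega> \<in> space M. card (targets N) \<le> fst \<omega> v \<and>
     (\<forall>i<card (targets N). hits (path_of (v, i) \<omega>) (from_nat_into (targets N) i))}"

lemma start_sets: "site v \<subseteq> J \<Longrightarrow> start v N \<in> sets (F J)"
  unfolding start_def
  by (intro F_setI pred_intros_logic pred_intros_countable pred_intros_imp' pred_F_tail pred_F_row)
    (auto simp: site_def)

text \<open>Only displacements from \<open>v\<close> enter, so all vertices have the same chance
  \<open>\<pi>\<close>, and among many vertices one succeeds with probability close to 1.\<close>

lemma prob_start_pos: "\<exists>\<pi>>0. \<forall>v. v \<noteq> 0 \<longrightarrow> M.prob (start v N) = \<pi>"
proof (intro exI conjI allI impI)
  let ?m = "card (targets N)" and ?h = "from_nat_into (targets N)"
  show "0 < measure (measure_pmf \<mu>) {?m..} * (\<Prod>i<?m. H (?h i))"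
    by (intro mult_pos_pos tail_pos prod_pos H_pos)
  fix v :: "int ^ 'd" assume "v \<noteq> 0"
  then have "M.prob (start v N) = measure (measure_pmf \<mu>) {?m..} *
      M.prob {\<omega> \<in> space M. \<forall>i<?m. hits (path_of (v, i) \<omega>) (?h i)}"
    unfolding start_def
    by (intro prob_tail_Int pred_intros_countable pred_intros_imp' pred_F_row order_refl)
  then show "M.prob (start v N) = measure (measure_pmf \<mu>) {?m..} * (\<Prod>i<?m. H (?h i))"
    by (simp only: prob_all_rows_hit)
qed

text \<open>A finite substitute for the infinite range of the initial frog: \<open>L\<close>
  distinct vertices are described by the single vertex \<open>w\<close>, so the random set of
  vertices met becomes a countable index.\<close>

definition line :: "nat \<Rightarrow> int ^ 'd \<Rightarrow> ((int ^ 'd \<Rightarrow> nat) \<times> ('d frog \<times> nat \<Rightarrow> int ^ 'd)) set" where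
  "line L w = {\<omega> \<in> space M. \<forall>i<L. hits (path_of (0, 0) \<omega>) (w + axis j1 (int i))}"

lemma line_sets: "line L w \<in> sets (F origin_row)"
  unfolding line_def
  by (intro F_setI pred_intros_countable pred_intros_imp' pred_F_row_hits) (auto simp: origin_row_def)

lemma hits_run:
  assumes "\<forall>i<L. s (k + i) = axis j1 1" "i < L"
  shows "hits s ((\<Sum>l<k. s l) + axis j1 (int i))"
proof -
  have "(\<Sum>l<k + i. s l) = (\<Sum>l<k. s l) + axis j1 (int i)"
    using \<open>i < L\<close>
  proof (induction i)
    case 0
    have "axis j1 (0 :: int) = 0" by (simp add: vec_eq_iff axis_def)
    then show ?case by simp
  next
    case (Suc i)
    have "axis j1 (int (Suc i)) = axis j1 (int i) + axis j1 1" by (simp add: vec_eq_iff axis_def)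
    then show ?case using Suc assms(1) by (simp add: ac_simps)
  qed
  then show ?thesis unfolding hits_def by blast
qed

lemma prob_line: "M.prob (\<Union>w. line L w) = 1"
proof -
  have ev: "(\<Union>w. line L w) \<in> M.events"
    using line_sets sets_F_events[OF origin_row_sub] by (intro sets.countable_UN) blast
  have "axis j1 1 \<in> unit_steps" by (auto simp: unit_steps_def)
  from AE_row[OF AE_path_run[OF this, of L], of "(0, 0)"]
  have "AE \<omega> in M. \<exists>k. \<forall>i<L. path_of (0, 0) \<omega> (k + i) = axis j1 1" .
  then have "AE \<omega> in M. \<omega> \<in> (\<Union>w. line L w)"
    using AE_space
  proof eventually_elim
    case (elim \<omega>)
    then obtain k where "\<forall>i<L. path_of (0, 0) \<omega> (k + i) = axis j1 1" by blast
    then have "\<omega> \<in> line L (\<Sum>l<k. path_of (0, 0) \<omega> l)"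
      using elim(2) hits_run[of L "path_of (0, 0) \<omega>" k] unfolding line_def by blast
    then show ?case by blast
  qed
  then show ?thesis using ev by (simp only: M.prob_eq_1)
qed

definition start_on_line :: "nat \<Rightarrow> nat \<Rightarrow> int ^ 'd \<Rightarrow> ((int ^ 'd \<Rightarrow> nat) \<times> ('d frog \<times> nat \<Rightarrow> int ^ 'd)) set" where
  "start_on_line N L w = (\<Union>v\<in>{v. \<exists>i<L. v = w + axis j1 (int i) \<and> even (v $ j1) \<and> v \<noteq> 0}. start v N)"

lemma start_on_line_sets: "start_on_line N L w \<in> sets (F even_coords)"
  unfolding start_on_line_def
proof (rule sets.finite_UN)
  show "finite {v. \<exists>i<L. v = w + axis j1 (int i) \<and> even (v $ j1) \<and> v \<noteq> 0}"
    by (rule finite_subset[of _ "(\<lambda>i. w + axis j1 (int i)) ` {..<L}"]) auto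
  fix v assume "v \<in> {v. \<exists>i<L. v = w + axis j1 (int i) \<and> even (v $ j1) \<and> v \<noteq> 0}"
  then have "v \<in> {x. even (x $ j1) \<and> x \<noteq> 0}" by blast
  then show "start v N \<in> sets (F even_coords)"
    unfolding even_coords_def by (intro start_sets UN_upper)
qed

lemma card_line_even_ge:
  "L div 2 - 1 \<le> card {v. \<exists>i<L. v = w + axis j1 (int i) \<and> even (v $ j1) \<and> v \<noteq> 0}"
    (is "_ \<le> card ?V")
proof -
  \<comment> \<open>The removed index is the only one that can lead to layer 0, and thus to the
    origin; for \<open>w $ j1 > 0\<close> it costs at most one vertex.\<close>
  let ?I = "{i. i < L \<and> even (w $ j1 + int i)} - {nat (- (w $ j1))}"
  let ?f = "\<lambda>i. w + axis j1 (int i)"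
  have f: "?f i $ j1 = w $ j1 + int i" for i by (simp add: axis_def)
  have fin: "finite ?V" by (rule finite_subset[of _ "?f ` {..<L}"]) auto
  have inj: "inj_on ?f ?I"
  proof (rule inj_onI)
    fix i i' assume "?f i = ?f i'"
    then have "?f i $ j1 = ?f i' $ j1" by simp
    then show "i = i'" by (simp only: f)
  qed
  have sub: "?f ` ?I \<subseteq> ?V"
  proof
    fix v assume "v \<in> ?f ` ?I"
    then obtain i where i: "i < L" "even (w $ j1 + int i)" "i \<noteq> nat (- (w $ j1))" and v: "v = ?f i" by blast
    have "v $ j1 = w $ j1 + int i" unfolding v by (rule f)
    moreover have "w $ j1 + int i \<noteq> 0" using i(3) by linarith
    ultimately have "even (v $ j1)" "v $ j1 \<noteq> 0" using i(2) by auto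
    then have "v \<noteq> 0" by (metis zero_index)
    with i(1) v \<open>even (v $ j1)\<close> show "v \<in> ?V" by blast
  qed
  have "L div 2 - 1 \<le> card {i. i < L \<and> even (w $ j1 + int i)} - 1"
    using card_even_shift_ge[of L "w $ j1"] by linarith
  also have "\<dots> \<le> card ?I"
    using diff_card_le_card_Diff[of "{nat (- (w $ j1))}" "{i. i < L \<and> even (w $ j1 + int i)}"] by simp
  also have "\<dots> = card (?f ` ?I)" by (rule card_image[OF inj, symmetric])
  also have "\<dots> \<le> card ?V" by (rule card_mono[OF fin sub])
  finally show ?thesis .
qed

lemma prob_start_on_line_ge:
  assumes \<pi>: "0 < \<pi>" "\<And>v. v \<noteq> 0 \<Longrightarrow> M.prob (start v N) = \<pi>"
  shows "1 - exp (- (real (L div 2 - 1) * \<pi>)) \<le> M.prob (start_on_line N L w)"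
proof -
  let ?V = "{v. \<exists>i<L. v = w + axis j1 (int i) \<and> even (v $ j1) \<and> v \<noteq> 0}"
  have fin: "finite ?V"
    by (rule finite_subset[of _ "(\<lambda>i. w + axis j1 (int i)) ` {..<L}"]) auto
  have ev: "start_on_line N L w \<in> M.events"
    using start_on_line_sets sets_F_events[OF even_coords_sub] by blast
  have "space M - start_on_line N L w = {\<omega> \<in> space M. \<forall>v\<in>?V. \<omega> \<notin> start v N}"
    unfolding start_on_line_def by blast
  then have "1 - M.prob (start_on_line N L w) = M.prob {\<omega> \<in> space M. \<forall>v\<in>?V. \<omega> \<notin> start v N}"
    using M.prob_compl[OF ev] by (simp only:)
  also have "\<dots> \<le> exp (- (\<Sum>v\<in>?V. M.prob (start v N)))"
  proof (rule prob_avoid_F[OF fin])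
    show "site v \<subseteq> coords" if "v \<in> ?V" for v using that by (intro site_coords) blast
    show "disjoint_family_on site ?V" unfolding disjoint_family_on_def by (simp add: site_disjoint)
  qed (rule start_sets[OF order_refl])
  also have "(\<Sum>v\<in>?V. M.prob (start v N)) = (\<Sum>v\<in>?V. \<pi>)"
    using \<pi>(2) by (intro sum.cong) auto
  also have "\<dots> = real (card ?V) * \<pi>" by (rule sum_constant)
  also have "exp (- (real (card ?V) * \<pi>)) \<le> exp (- (real (L div 2 - 1) * \<pi>))"
    unfolding exp_le_cancel_iff neg_le_iff_le
    using card_line_even_ge[of L w] \<pi>(1) by (intro mult_right_mono) (simp_all only: of_nat_le_iff less_imp_le)
  finally show ?thesis by linarith
qed

definition seed :: "nat \<Rightarrow> int ^ 'd \<Rightarrow> ((int ^ 'd \<Rightarrow> nat) \<times> ('d frog \<times> nat \<Rightarrow> int ^ 'd)) set" where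
  "seed N v = (if even (v $ j1) \<and> v \<noteq> 0
     then {\<omega> \<in> space M. hits (path_of (0, 0) \<omega>) v} \<inter> start v N else {})"

lemma seed_sets: "seed N v \<in> sets (F (origin_row \<union> even_coords))"
proof (cases "even (v $ j1) \<and> v \<noteq> 0")
  case True
  have "{\<omega> \<in> space M. hits (path_of (0, 0) \<omega>) v} \<in> sets (F (origin_row \<union> even_coords))"
    by (intro F_setI pred_F_row_hits) (simp add: origin_row_def)
  moreover have "start v N \<in> sets (F (origin_row \<union> even_coords))"
    using True by (intro start_sets le_supI2) (auto simp: even_coords_def)
  ultimately show ?thesis unfolding seed_def using True by (simp only: if_True sets.Int simp_thms)
qed (simp only: seed_def if_False sets.empty_sets)

text \<open>The path of the initial frog selects \<open>w\<close>, the even sites are independent of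
  it, and every line contains a successful start with probability at least
  \<open>1 - \<epsilon>\<close> once \<open>L\<close> is large.\<close>

lemma prob_seed: "M.prob (\<Union>v. seed N v) = 1"
proof -
  obtain \<pi> where \<pi>: "0 < \<pi>" "\<And>v. v \<noteq> 0 \<Longrightarrow> M.prob (start v N) = \<pi>"
    using prob_start_pos by blast
  have seed_ev: "(\<Union>v. seed N v) \<in> M.events"
    using seed_sets sets_F_events[of "origin_row \<union> even_coords"] origin_row_sub even_coords_sub
    by (intro sets.countable_UN) blast
  have "1 - \<epsilon> \<le> M.prob (\<Union>v. seed N v)" if "0 < \<epsilon>" for \<epsilon>
  proof -
    obtain m :: nat where m: "- ln \<epsilon> / \<pi> \<le> m" using real_arch_simple by blast
    \<comment> \<open>Chosen such that \<open>L div 2 - 1 = m\<close>: half of the layers are even,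
      and one vertex may be lost to the origin.\<close>
    define L where "L = 2 * (m + 1)"
    have "exp (- (real m * \<pi>)) \<le> exp (ln \<epsilon>)"
      using m \<pi>(1) by (simp add: field_simps)
    then have e: "exp (- (real (L div 2 - 1) * \<pi>)) \<le> \<epsilon>" using that by (simp add: L_def)
    have "(1 - \<epsilon>) * M.prob (\<Union>w. line L w) \<le> M.prob (\<Union>w. line L w \<inter> start_on_line N L w)"
    proof (rule M.prob_sub_sigma_select)
      show "M.prob (C \<inter> D) = M.prob C * M.prob D" if "C \<in> sets (F origin_row)" "D \<in> sets (F even_coords)" for C D
        by (rule prob_Int_F[OF origin_row_sub even_coords_sub origin_even_disjoint that])
      show "1 - \<epsilon> \<le> M.prob (start_on_line N L w)" for w
        using prob_start_on_line_ge[of \<pi> N L w] \<pi> e by force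
    qed (rule sets_F_events[OF origin_row_sub] sets_F_events[OF even_coords_sub] line_sets start_on_line_sets)+
    also have "\<dots> \<le> M.prob (\<Union>v. seed N v)"
    proof (rule M.finite_measure_mono[OF _ seed_ev])
      show "(\<Union>w. line L w \<inter> start_on_line N L w) \<subseteq> (\<Union>v. seed N v)"
      proof
        fix \<omega> assume "\<omega> \<in> (\<Union>w. line L w \<inter> start_on_line N L w)"
        then obtain w i v where "\<omega> \<in> line L w" "i < L" "v = w + axis j1 (int i)"
          and v: "even (v $ j1)" "v \<noteq> 0" "\<omega> \<in> start v N"
          unfolding start_on_line_def by blast
        then have "\<omega> \<in> {\<omega> \<in> space M. hits (path_of (0, 0) \<omega>) v}" unfolding line_def by blast
        then have "\<omega> \<in> seed N v" using v unfolding seed_def by auto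
        then show "\<omega> \<in> (\<Union>v. seed N v)" by blast
      qed
    qed
    finally show ?thesis by (simp only: prob_line mult_1_right)
  qed
  then have "1 \<le> M.prob (\<Union>v. seed N v) + \<epsilon>" if "0 < \<epsilon>" for \<epsilon> using that by force
  then have "1 \<le> M.prob (\<Union>v. seed N v)" by (rule field_le_epsilon)
  then show ?thesis by (simp only: M.prob_le_1 order_antisym)
qed

section \<open>Returns to the origin\<close>

lemma prob_return_ge:
  "\<exists>C>0. \<forall>v n z. (\<Sum>j\<in>UNIV. \<bar>v $ j\<bar>) < int n \<longrightarrow> z \<in> parabola j1 n \<longrightarrow>
    (1 - exp (-1)) * measure (measure_pmf \<mu>) {k. exp (C * real n) \<le> real k}
    \<le> M.prob {\<omega> \<in> space M. nat \<lceil>exp (C * real n)\<rceil> \<le> fst \<omega> (v + z) \<and>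
          (\<exists>i<nat \<lceil>exp (C * real n)\<rceil>. hits (path_of (v + z, i) \<omega>) (- (v + z)))}"
proof -
  obtain k where "0 < k" "k \<le> 1" and k_le: "\<And>i. k \<le> q i" using ex_q_lower_bound by blast
  \<comment> \<open>The way back from \<open>v + z\<close> has at most
    \<open>(CARD('d) + 1) * n\<close> steps, so a frog returns with probability at least
    \<open>k ^ ((CARD('d) + 1) * n)\<close>. Among \<open>exp (C * n)\<close> frogs the expected
    number of returns is then at least \<open>exp n \<ge> 1\<close>, and some frog returns with
    probability at least \<open>1 - exp (-1)\<close>.\<close>
  define C where "C = 1 - (real CARD('d) + 1) * ln k"
  have "(real CARD('d) + 1) * ln k \<le> 0"
    using \<open>0 < k\<close> \<open>k \<le> 1\<close> by (intro mult_nonneg_nonpos) auto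
  then have "0 < C" by (simp add: C_def)
  have "(1 - exp (-1)) * measure (measure_pmf \<mu>) {k. exp (C * real n) \<le> real k}
    \<le> M.prob {\<omega> \<in> space M. m \<le> fst \<omega> (v + z) \<and> (\<exists>i<m. hits (path_of (v + z, i) \<omega>) (- (v + z)))}"
    if v: "(\<Sum>j\<in>UNIV. \<bar>v $ j\<bar>) < int n" and z: "z \<in> parabola j1 n"
      and m: "m = nat \<lceil>exp (C * real n)\<rceil>" for v :: "int ^ 'd" and n z m
  proof -
    have "\<bar>v $ j1\<bar> \<le> (\<Sum>j\<in>UNIV. \<bar>v $ j\<bar>)" by (rule member_le_sum) auto
    then have "(v + z) $ j1 \<noteq> 0" using v parabola_layer[OF z] by simp
    then have nz: "v + z \<noteq> 0" by (metis zero_index)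
    have "(\<Sum>j\<in>UNIV. \<bar>(- (v + z)) $ j\<bar>) \<le> (\<Sum>j\<in>UNIV. \<bar>v $ j\<bar> + \<bar>z $ j\<bar>)"
      by (intro sum_mono) simp
    also have "\<dots> \<le> int n + int (CARD('d) * n)"
      using v parabola_norm_le[OF z] by (simp add: sum.distrib)
    finally have le: "(\<Sum>j\<in>UNIV. \<bar>(- (v + z)) $ j\<bar>) \<le> int ((CARD('d) + 1) * n)"
      by (simp add: algebra_simps)
    define l where "l = nat (\<Sum>j\<in>UNIV. \<bar>(- (v + z)) $ j\<bar>)"
    have l: "(\<Sum>j\<in>UNIV. \<bar>(- (v + z)) $ j\<bar>) = int l" unfolding l_def by (simp add: sum_nonneg)
    then have "l \<le> (CARD('d) + 1) * n" using le by linarith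
    then have "k ^ ((CARD('d) + 1) * n) \<le> k ^ l"
      using \<open>0 < k\<close> \<open>k \<le> 1\<close> by (intro power_decreasing) auto
    also have "\<dots> \<le> H (- (v + z))" by (rule H_ge_power[OF \<open>0 < k\<close> k_le l])
    finally have Hk: "k ^ ((CARD('d) + 1) * n) \<le> H (- (v + z))" .
    have "1 \<le> exp (real n)" by simp
    also have "exp (real n) = exp (C * real n + real ((CARD('d) + 1) * n) * ln k)"
      unfolding C_def by (simp add: algebra_simps)
    also have "\<dots> = exp (C * real n) * k ^ ((CARD('d) + 1) * n)"
      using \<open>0 < k\<close> by (simp only: exp_add exp_of_nat_mult exp_ln)
    also have "\<dots> \<le> real m * H (- (v + z))"
    proof -
      have "exp (C * real n) \<le> real m" unfolding m by (rule real_nat_ceiling_ge)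
      then show ?thesis using \<open>0 < k\<close> by (intro mult_mono Hk) auto
    qed
    finally have "exp (- (real m * H (- (v + z)))) \<le> exp (-1)" by simp
    then have "1 - exp (-1) \<le> M.prob {\<omega> \<in> space M. \<exists>i<m. hits (path_of (v + z, i) \<omega>) (- (v + z))}"
      using prob_some_row_hits[of m "- (v + z)" "v + z"] by linarith
    then have "measure (measure_pmf \<mu>) {m..} * (1 - exp (-1)) \<le> measure (measure_pmf \<mu>) {m..} *
        M.prob {\<omega> \<in> space M. \<exists>i<m. hits (path_of (v + z, i) \<omega>) (- (v + z))}"
      by (intro mult_left_mono) auto
    also have "\<dots> = M.prob {\<omega> \<in> space M. m \<le> fst \<omega> (v + z) \<and> (\<exists>i<m. hits (path_of (v + z, i) \<omega>) (- (v + z)))}"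
      by (intro prob_tail_Int[symmetric] nz pred_intros_countable pred_intros_conj1' pred_F_row order_refl)
    also have "{m..} = {k. exp (C * real n) \<le> real k}"
      unfolding m by (auto simp: nat_ceiling_le_eq)
    finally show ?thesis by (simp only: mult.commute)
  qed
  with \<open>0 < C\<close> show ?thesis by blast
qed

text \<open>Layer \<open>n\<close> offers at least \<open>n^((d-1)/2)\<close> independent chances,
  and the resulting series diverges. There are countably many pairs \<open>v\<close>,
  \<open>N\<close>, so the statement holds for all of them at once and applies to a random
  \<open>v\<close>.\<close>

lemma AE_returns:
  "AE \<omega> in M. \<forall>v N. \<exists>n\<ge>N. \<exists>z\<in>parabola j1 n. v + z \<noteq> 0 \<and>
     (\<exists>i<fst \<omega> (v + z). hits (path_of (v + z, i) \<omega>) (- (v + z)))"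
  unfolding AE_all_countable
proof (intro allI)
  fix v :: "int ^ 'd" and N :: nat
  obtain C where "0 < C" and C: "\<And>v n z. (\<Sum>j\<in>UNIV. \<bar>v $ j\<bar>) < int n \<Longrightarrow> z \<in> parabola j1 n \<Longrightarrow>
    (1 - exp (-1)) * measure (measure_pmf \<mu>) {k. exp (C * real n) \<le> real k}
    \<le> M.prob {\<omega> \<in> space M. nat \<lceil>exp (C * real n)\<rceil> \<le> fst \<omega> (v + z) \<and>
          (\<exists>i<nat \<lceil>exp (C * real n)\<rceil>. hits (path_of (v + z, i) \<omega>) (- (v + z)))}"
    using prob_return_ge by blast
  define b :: real where "b = 1 - exp (-1)"
  have "0 < b" by (simp add: b_def)
  \<comment> \<open>Beyond the l1-norm of \<open>v\<close> the vertices \<open>v + z\<close> avoid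
    the origin and the return estimate applies.\<close>
  define N1 where "N1 = max N (nat (\<Sum>j\<in>UNIV. \<bar>v $ j\<bar>) + 1)"
  have N1: "(\<Sum>j\<in>UNIV. \<bar>v $ j\<bar>) < int n" "N \<le> n" if "N1 \<le> n" for n
    using that unfolding N1_def by linarith+
  define g where "g n = sqrt (real n) ^ (CARD('d) - 1) *
    measure (measure_pmf \<mu>) {k. exp (C * real n) \<le> real k}" for n
  have g0: "0 \<le> g n" for n by (simp add: g_def)
  define A where "A n z = {\<omega> \<in> space M. nat \<lceil>exp (C * real n)\<rceil> \<le> fst \<omega> (v + z) \<and>
          (\<exists>i<nat \<lceil>exp (C * real n)\<rceil>. hits (path_of (v + z, i) \<omega>) (- (v + z)))}" for n z
  have A_sets: "A n z \<in> sets (F (site (v + z)))" for n z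
    unfolding A_def
    by (intro F_setI pred_intros_logic pred_intros_countable pred_intros_conj1' pred_F_tail pred_F_row)
      (auto simp: site_def)
  have nz: "v + z \<noteq> 0" if "N1 \<le> n" "z \<in> parabola j1 n" for n z
  proof -
    have "\<bar>v $ j1\<bar> \<le> (\<Sum>j\<in>UNIV. \<bar>v $ j\<bar>)" by (rule member_le_sum) auto
    then have "(v + z) $ j1 \<noteq> 0" using N1(1)[OF that(1)] parabola_layer[OF that(2)] by simp
    then show ?thesis by (metis zero_index)
  qed
  define E where "E = {\<omega> \<in> space M. \<forall>n z. N1 \<le> n \<longrightarrow> z \<in> parabola j1 n \<longrightarrow> \<omega> \<notin> A n z}"
  have AF: "A n z \<in> sets (F coords)" if "v + z \<noteq> 0" for n z
    using A_sets[of n z] sets_F_mono[OF site_coords[OF that]] by blast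
  have E_ev: "E \<in> M.events"
  proof -
    have "E \<in> sets (F coords)"
      unfolding E_def
    proof (intro F_setI pred_intros_countable pred_intros_imp' pred_intros_logic)
      fix n z assume "N1 \<le> n" "z \<in> parabola j1 n"
      from pred_sets2[OF AF[OF nz[OF this], of n] measurable_ident]
      show "Measurable.pred (F coords) (\<lambda>\<omega>. \<omega> \<in> A n z)" by (simp only: id_apply)
    qed
    then show ?thesis using sets_F_events[OF order_refl] by blast
  qed
  have bound: "M.prob E \<le> exp (- (b * (\<Sum>i<k. g (i + N1))))" for k
  proof -
    let ?K = "SIGMA i:{..<k}. parabola j1 (i + N1)"
    have fin: "finite ?K" by (intro finite_SigmaI finite_lessThan finite_parabola)
    have "b * (\<Sum>i<k. g (i + N1)) = (\<Sum>i<k. b * g (i + N1))" by (rule sum_distrib_left)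
    also have "\<dots> \<le> (\<Sum>i<k. \<Sum>z\<in>parabola j1 (i + N1). M.prob (A (i + N1) z))"
    proof (rule sum_mono)
      fix i
      define n where "n = i + N1"
      let ?t = "b * measure (measure_pmf \<mu>) {k. exp (C * real n) \<le> real k}"
      have "0 \<le> ?t" using \<open>0 < b\<close> by simp
      have "b * g n = sqrt (real n) ^ (CARD('d) - 1) * ?t" by (simp add: g_def)
      also have "\<dots> \<le> card (parabola j1 n) * ?t"
        by (rule mult_right_mono[OF card_parabola_ge \<open>0 \<le> ?t\<close>])
      also have "\<dots> = (\<Sum>z\<in>parabola j1 n. ?t)" by (simp only: sum_constant)
      also have "\<dots> \<le> (\<Sum>z\<in>parabola j1 n. M.prob (A n z))"
        unfolding A_def b_def by (intro sum_mono C N1(1)) (simp_all add: n_def)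
      finally show "b * g (i + N1) \<le> (\<Sum>z\<in>parabola j1 (i + N1). M.prob (A (i + N1) z))"
        unfolding n_def .
    qed
    also have "\<dots> = (\<Sum>(i, z)\<in>?K. M.prob (A (i + N1) z))"
      by (rule sum.Sigma) (simp_all add: finite_parabola)
    finally have sum: "b * (\<Sum>i<k. g (i + N1)) \<le> (\<Sum>x\<in>?K. M.prob (A (fst x + N1) (snd x)))"
      by (simp only: case_prod_unfold)
    have "M.prob E \<le> M.prob {\<omega> \<in> space M. \<forall>x\<in>?K. \<omega> \<notin> A (fst x + N1) (snd x)}"
    proof (rule M.finite_measure_mono)
      show "E \<subseteq> {\<omega> \<in> space M. \<forall>x\<in>?K. \<omega> \<notin> A (fst x + N1) (snd x)}"
        unfolding E_def by auto
      have "A (fst x + N1) (snd x) \<in> M.events" if "x \<in> ?K" for x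
      proof -
        have "v + snd x \<noteq> 0" using that by (intro nz[of "fst x + N1"]) auto
        from AF[OF this] show ?thesis using sets_F_events[OF order_refl] by blast
      qed
      then have "space M - (\<Union>x\<in>?K. A (fst x + N1) (snd x)) \<in> M.events"
        by (intro sets.Diff sets.top sets.finite_UN fin)
      moreover have "{\<omega> \<in> space M. \<forall>x\<in>?K. \<omega> \<notin> A (fst x + N1) (snd x)}
          = space M - (\<Union>x\<in>?K. A (fst x + N1) (snd x))" by blast
      ultimately show "{\<omega> \<in> space M. \<forall>x\<in>?K. \<omega> \<notin> A (fst x + N1) (snd x)} \<in> M.events"
        by (simp only:)
    qed
    also have "\<dots> \<le> exp (- (\<Sum>x\<in>?K. M.prob (A (fst x + N1) (snd x))))"
    proof (rule prob_avoid_F[OF fin, where J = "\<lambda>x. site (v + snd x)"])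
      show "site (v + snd x) \<subseteq> coords" if "x \<in> ?K" for x
        using that by (intro site_coords nz[of "fst x + N1"]) auto
      show "disjoint_family_on (\<lambda>x. site (v + snd x)) ?K"
        unfolding disjoint_family_on_def
      proof (intro ballI impI site_disjoint notI)
        fix x y assume xy: "x \<in> ?K" "y \<in> ?K" "x \<noteq> y" "v + snd x = v + snd y"
        then have "snd x = snd y" by simp
        moreover have "snd x $ j1 = int (fst x + N1)" "snd y $ j1 = int (fst y + N1)"
          using xy(1,2) by (auto dest: parabola_layer)
        ultimately show False using \<open>x \<noteq> y\<close> by (simp add: prod_eq_iff)
      qed
    qed (rule A_sets)
    also have "\<dots> \<le> exp (- (b * (\<Sum>i<k. g (i + N1))))" using sum by simp
    finally show ?thesis .
  qed
  \<comment> \<open>Otherwise the bound on \<open>M.prob E\<close>, after taking logarithms, would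
    bound all partial sums of the divergent series.\<close>
  have "M.prob E = 0"
  proof (rule ccontr)
    assume "M.prob E \<noteq> 0"
    then have pos: "0 < M.prob E" by (simp add: zero_less_measure_iff)
    have "(\<Sum>i<k. g (i + N1)) \<le> - ln (M.prob E) / b" for k
    proof -
      have "ln (M.prob E) \<le> - (b * (\<Sum>i<k. g (i + N1)))"
        using ln_mono[OF bound[of k] pos] by (simp only: ln_exp)
      then show ?thesis using \<open>0 < b\<close> by (simp add: field_simps)
    qed
    then have "summable (\<lambda>i. g (i + N1))" by (intro summableI_nonneg_bounded g0)
    then have "summable g" by (simp only: summable_iff_shift)
    then show False using not_summable_tail[OF \<open>0 < C\<close>] unfolding g_def by blast
  qed
  then have "AE \<omega> in M. \<omega> \<notin> E" using E_ev by (simp only: M.prob_eq_0)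
  then show "AE \<omega> in M. \<exists>n\<ge>N. \<exists>z\<in>parabola j1 n. v + z \<noteq> 0 \<and>
     (\<exists>i<fst \<omega> (v + z). hits (path_of (v + z, i) \<omega>) (- (v + z)))"
    using AE_space
  proof eventually_elim
    case (elim \<omega>)
    then obtain n z where n: "N1 \<le> n" "z \<in> parabola j1 n" "\<omega> \<in> A n z" unfolding E_def by blast
    then obtain i where "i < fst \<omega> (v + z)" "hits (path_of (v + z, i) \<omega>) (- (v + z))"
      unfolding A_def by (blast intro: less_le_trans)
    with n nz[OF n(1,2)] N1(2)[OF n(1)] show ?case by blast
  qed
qed

text \<open>Purely deterministic, by strong induction on the layer. Below \<open>N\<close> the frogs
  of \<open>v\<close> do the work; from \<open>N\<close> on \<open>source\<close> supplies a frog in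
  a layer at most half as high, awake by induction, whose path reaches \<open>z\<close>.\<close>

lemma seed_spread_visited:
  assumes "1 \<le> N" and seed: "\<omega> \<in> seed N v" and spread: "\<omega> \<in> spread v N"
    and "1 \<le> n" "z \<in> parabola j1 n"
  shows "visited (fst \<omega>) (snd \<omega>) (v + z)"
  using assms(4,5)
proof (induction n arbitrary: z rule: less_induct)
  case (less n)
  have v: "even (v $ j1)" "v \<noteq> 0" "hits (path_of (0, 0) \<omega>) v" "\<omega> \<in> start v N"
    using seed by (auto simp: seed_def split: if_splits)
  have z_nz: "z \<noteq> 0"
  proof
    assume "z = 0"
    then show False using parabola_layer[OF less.prems(2)] less.prems(1) by simp
  qed
  show ?case
  proof (cases "n < N")
    case True
    have "visited (fst \<omega>) (snd \<omega>) (fst (0, 0 :: nat) + v)"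
      using v by (intro active_imp_visited[OF active_origin]) (auto simp: path_of_def)
    then have vis: "visited (fst \<omega>) (snd \<omega>) v" by simp
    have "z \<in> targets N" using True less.prems unfolding targets_def by auto
    then obtain i where i: "i < card (targets N)" "from_nat_into (targets N) i = z"
      using bij_betw_from_nat_into_finite[OF finite_targets[of N]]
      by (metis bij_betw_imp_surj_on imageE lessThan_iff)
    then have "i < fst \<omega> v" "hits (path_of (v, i) \<omega>) z"
      using v(4) unfolding start_def by auto
    then have "visited (fst \<omega>) (snd \<omega>) (fst (v, i) + z)"
      using visited_imp_active[OF vis v(2)] z_nz by (intro active_imp_visited) (auto simp: path_of_def)
    then show ?thesis by simp
  next
    case False
    then have "source v n z \<omega>" using spread less.prems unfolding spread_def by auto
    then obtain s w where s: "odd s" "n \<le> 4 * s" "2 * s \<le> n" "w \<in> parabola j1 s"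
      and w: "1 \<le> fst \<omega> (v + w)" "hits (path_of (v + w, 0) \<omega>) (z - w)"
      unfolding source_def by blast
    have "s < n" "1 \<le> s" using s less.prems(1) by linarith+
    then have vis: "visited (fst \<omega>) (snd \<omega>) (v + w)" using less.IH s(4) by blast
    have "(v + w) $ j1 \<noteq> 0"
    proof
      assume "(v + w) $ j1 = 0"
      then have "v $ j1 = - int s" using parabola_layer[OF s(4)] by simp
      then show False using v(1) s(1) by simp
    qed
    then have "v + w \<noteq> 0" by (metis zero_index)
    then have act: "active (fst \<omega>) (snd \<omega>) (v + w, 0)"
      using w(1) by (intro visited_imp_active[OF vis]) auto
    have "z - w \<noteq> 0"
      using parabola_layer[OF s(4)] parabola_layer[OF less.prems(2)] \<open>s < n\<close> by auto
    then have "visited (fst \<omega>) (snd \<omega>) (fst (v + w, 0 :: nat) + (z - w))"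
      using w(2) by (intro active_imp_visited[OF act]) (auto simp: path_of_def)
    then show ?thesis by simp
  qed
qed

text \<open>\<open>seed\<close> is determined by the initial path and the even sites,
  \<open>spread\<close> by the odd sites. So with probability at least \<open>1 - \<epsilon>\<close>
  both occur at the same random \<open>v\<close>, and then infinitely many distinct awake frogs pass
  through 0.\<close>

theorem recurrent: "frog_prob p \<mu> origin_visited_infinitely_often = 1"
proof (rule frog_prob_eq_1[OF _ recurrence_event])
  let ?R = "{\<omega> \<in> space M. frog_path (fst \<omega>) (snd \<omega>) \<in> origin_visited_infinitely_often}"
  let ?ret = "\<lambda>\<omega>. \<forall>v N. \<exists>n\<ge>N. \<exists>z\<in>parabola j1 n. v + z \<noteq> 0 \<and>
     (\<exists>i<fst \<omega> (v + z). hits (path_of (v + z, i) \<omega>) (- (v + z)))"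
  have rec: "\<omega> \<in> ?R" if "\<omega> \<in> space M" "?ret \<omega>" "1 \<le> N" "\<omega> \<in> seed N v" "\<omega> \<in> spread v N" for \<omega> N v
  proof -
    let ?S = "{f. active (fst \<omega>) (snd \<omega>) f \<and> hits (\<lambda>k. snd \<omega> (f, k)) (- fst f)}"
    have "infinite ?S"
    proof
      assume "finite ?S"
      then have fin: "finite ((\<lambda>f. nat ((fst f - v) $ j1)) ` ?S)" by (rule finite_imageI)
      \<comment> \<open>Exceeds every layer, relative to \<open>v\<close>, from which a frog of
        \<open>?S\<close> starts; a return from a layer \<open>n \<ge> N'\<close> is then a
        contradiction.\<close>
      define N' where "N' = Suc (Max (insert 0 ((\<lambda>f. nat ((fst f - v) $ j1)) ` ?S)))"
      obtain n z i where n: "N' \<le> n" "z \<in> parabola j1 n" "v + z \<noteq> 0" "i < fst \<omega> (v + z)"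
        "hits (path_of (v + z, i) \<omega>) (- (v + z))" using \<open>?ret \<omega>\<close> by blast
      have "1 \<le> n" using n(1) by (simp add: N'_def)
      then have "visited (fst \<omega>) (snd \<omega>) (v + z)"
        by (rule seed_spread_visited[OF that(3-5) _ n(2)])
      then have "active (fst \<omega>) (snd \<omega>) (v + z, i)" using n by (intro visited_imp_active)
      then have "(v + z, i) \<in> ?S" using n(5) by (simp add: path_of_def)
      then have "nat ((fst (v + z, i) - v) $ j1) \<in> insert 0 ((\<lambda>f. nat ((fst f - v) $ j1)) ` ?S)"
        by blast
      then have "nat ((fst (v + z, i) - v) $ j1) < N'"
        unfolding N'_def using fin by (intro le_imp_less_Suc Max_ge) auto
      then show False using n(1) parabola_layer[OF n(2)] by simp
    qed
    then show ?thesis using origin_visited_infinitely_oftenI[of "fst \<omega>" "snd \<omega>"] that(1) by blast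
  qed
  have "1 - \<epsilon> \<le> M.prob ?R" if "0 < \<epsilon>" for \<epsilon>
  proof -
    obtain N where "1 \<le> N" and N: "\<And>v. even (v $ j1) \<Longrightarrow> 1 - \<epsilon> \<le> M.prob (spread v N)"
      using prob_spread[OF \<open>0 < \<epsilon>\<close>] by blast
    \<comment> \<open>For \<open>v\<close> in an odd layer \<open>seed N v\<close> is empty, and the
      whole space keeps the lower bound valid for every index.\<close>
    define B where "B v = (if even (v $ j1) then spread v N else space M)" for v
    have B: "B v \<in> sets (F odd_coords)" for v
      unfolding B_def using spread_sets[of v N] sets.top[of "F odd_coords"] by simp
    have sub: "origin_row \<union> even_coords \<subseteq> coords" using origin_row_sub even_coords_sub by blast
    have "(1 - \<epsilon>) * M.prob (\<Union>v. seed N v) \<le> M.prob (\<Union>v. seed N v \<inter> B v)"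
    proof (rule M.prob_sub_sigma_select)
      show "M.prob (X \<inter> Y) = M.prob X * M.prob Y"
        if "X \<in> sets (F (origin_row \<union> even_coords))" "Y \<in> sets (F odd_coords)" for X Y
        by (rule prob_Int_F[OF sub odd_coords_sub even_odd_disjoint that])
      show "1 - \<epsilon> \<le> M.prob (B v)" for v
        using N[of v] that by (cases "even (v $ j1)") (simp_all add: B_def M.prob_space)
    qed (rule sets_F_events[OF sub] sets_F_events[OF odd_coords_sub] seed_sets B)+
    also have "\<dots> \<le> M.prob ?R"
    proof (rule M.finite_measure_mono_AE)
      show "AE \<omega> in M. \<omega> \<in> (\<Union>v. seed N v \<inter> B v) \<longrightarrow> \<omega> \<in> ?R"
        using AE_returns AE_space
      proof eventually_elim
        case (elim \<omega>)
        show ?case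
        proof
          assume "\<omega> \<in> (\<Union>v. seed N v \<inter> B v)"
          then obtain v where v: "\<omega> \<in> seed N v" "\<omega> \<in> B v" by blast
          then have "even (v $ j1)" by (auto simp: seed_def split: if_splits)
          then have "\<omega> \<in> spread v N" using v(2) by (simp add: B_def)
          then show "\<omega> \<in> ?R" by (rule rec[OF elim(2,1) \<open>1 \<le> N\<close> v(1)])
        qed
      qed
    qed (rule recurrence_event)
    finally show ?thesis by (simp only: prob_seed mult_1_right)
  qed
  then have "1 \<le> M.prob ?R + \<epsilon>" if "0 < \<epsilon>" for \<epsilon> using that by force
  then have "1 \<le> M.prob ?R" by (rule field_le_epsilon)
  then have "M.prob ?R = 1" by (simp only: M.prob_le_1 order_antisym)
  then have "AE \<omega> in M. \<omega> \<in> ?R" by (simp only: M.prob_eq_1[OF recurrence_event])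
  then show "AE \<omega> in M. frog_path (fst \<omega>) (snd \<omega>) \<in> origin_visited_infinitely_often" by eventually_elim simp
qed

end

theorem theorem2p1:
  fixes p :: "(int ^ 'd::finite) pmf" and \<mu> :: "nat pmf"
    and a :: real and j1 :: 'd and x :: "int ^ 'd"
  assumes "\<And>e. e \<in> unit_steps \<Longrightarrow> 0 < pmf p e \<and> pmf p e < 1"
    and "(\<Sum>e\<in>unit_steps. pmf p e) = 1"
    and "\<And>y. y \<notin> unit_steps \<Longrightarrow> pmf p y = 0"
    and "0 < a" and "a < 1"
    and "(\<Sum>e\<in>unit_steps. pmf p e *\<^sub>R real_vec e) = a *\<^sub>R axis j1 1"
    and "x \<noteq> 0"
    and "(\<integral>\<^sup>+ \<eta>. ennreal (log_plus (real (\<eta> x)) powr ((real CARD('d) + 1) / 2))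
            \<partial>(iid_config \<mu> :: (int ^ 'd \<Rightarrow> nat) measure)) = \<infinity>"
  shows "frog_prob p \<mu> origin_visited_infinitely_often = 1"
proof -
  interpret fm: frog_model p \<mu>
    using assms(1,2) by unfold_locales auto
  have drift: "fm.q (j, True) - fm.q (j, False) = (if j = j1 then a else 0)" for j
  proof -
    have "(\<Sum>e\<in>unit_steps. pmf p e *\<^sub>R real_vec e) $ j
        = (\<Sum>i\<in>UNIV. fm.q i * real_of_int (step i $ j))"
      unfolding range_step[symmetric]
      by (simp add: sum.reindex[OF inj_step] fm.q_def real_vec_def)
    also have "\<dots> = (\<Sum>k\<in>UNIV. \<Sum>b\<in>UNIV. fm.q (k, b) * real_of_int (step (k, b) $ j))"
      by (simp only: sum.cartesian_product UNIV_Times_UNIV case_prod_unfold prod.collapse)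
    also have "\<dots> = (\<Sum>k\<in>UNIV. if k = j then fm.q (j, True) - fm.q (j, False) else 0)"
      by (intro sum.cong) (auto simp: UNIV_bool step_nth)
    also have "\<dots> = fm.q (j, True) - fm.q (j, False)" by simp
    finally have "fm.q (j, True) - fm.q (j, False) = (a *\<^sub>R axis j1 1 :: real ^ 'd) $ j"
      using assms(6) by simp
    then show ?thesis by (simp add: axis_def)
  qed
  \<comment> \<open>The count at the fixed vertex \<open>x\<close> has law \<open>\<mu>\<close>,
    which turns the hypothesis into one on \<open>\<mu>\<close>.\<close>
  have log_moment: "(\<integral>\<^sup>+k. ennreal (log_plus (real k) powr ((real CARD('d) + 1) / 2)) \<partial>measure_pmf \<mu>) = \<infinity>"
  proof -
    have x: "x \<in> UNIV - {0}" using assms(7) by simp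
    have D: "distr (iid_config \<mu>) (measure_pmf \<mu>) (\<lambda>\<eta>. \<eta> x) = measure_pmf \<mu>"
      unfolding iid_config_def by (rule distr_PiM_component[OF measure_pmf.prob_space_axioms x])
    have "(\<lambda>\<eta>. \<eta> x) \<in> measurable (iid_config \<mu>) (measure_pmf \<mu>)"
      unfolding iid_config_def by (rule measurable_component_singleton[OF x])
    from nn_integral_distr[OF this, of "\<lambda>k. ennreal (log_plus (real k) powr ((real CARD('d) + 1) / 2))"]
    show ?thesis using assms(8) unfolding D by simp
  qed
  interpret drift_frog_model p \<mu> j1 a
    using assms(4,5) drift log_moment by unfold_locales auto
  show ?thesis by (rule recurrent)
qed

end
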